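(* For any $(\tilde\alpha,\tilde\beta,e)\in\mathcal R_{NH}\cup\mathcal R_{EH}$, every $1$-degenerate surface has even geometric multiplicity; that is, $\nu_1(\tilde\xi_{\tilde\alpha,\tilde\beta,e})=\dim\ker(\tilde\xi_{\tilde\alpha,\tilde\beta,e}(2\pi)-I_4)$ is even.
   Context: $\xi_{\alpha,\beta,e}$ is the fundamental solution ($\xi(0)=I_4$) on $[0,2\pi]$ of $\xi'=J\begin{pmatrix}1&0&0&1\\0&1&-1&0\\0&-1&1-\frac{1+\alpha+3\beta}{1+e\cos t}&0\\1&0&0&1-\frac{1+\alpha-3\beta}{1+e\cos t}\end{pmatrix}\xi$; with $\tilde\alpha=\alpha-\beta$, $\tilde\beta=-\alpha+3\beta-1$, $\tilde\xi_{\tilde\alpha,\tilde\beta,e}:=\xi_{\alpha,\beta,e}$. $\mathcal R_{NH}=\{-1<\tilde\beta<0,\tilde\alpha>0,e\in[0,1)\}$, $\mathcal R_{EH}=\{\tilde\beta>0,\tilde\alpha>0,e\in[0,1)\}$. Equivalently, the kernel of $\mathcal A(\alpha,\beta,e)=-\frac{d^2}{dt^2}I_2-I_2+\frac{1}{1+e\cos t}((1+\alpha)I_2+3\beta S(t))$, $S(t)=\begin{pmatrix}\cos2t&\sin2t\\\sin2t&-\cos2t\end{pmatrix}$, on $2\pi$-periodic $W^{2,2}$ functions has even dimension. *)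

theory Defs
  imports "HOL-Analysis.Analysis"
begin

definition Jmat :: "real^4^4" where
  "Jmat = vector [vector [0, 0, -1, 0],
                  vector [0, 0, 0, -1],
                  vector [1, 0, 0, 0],
                  vector [0, 1, 0, 0]]"

definition Bmat :: "real \<Rightarrow> real \<Rightarrow> real \<Rightarrow> real \<Rightarrow> real^4^4" where
  "Bmat \<alpha> \<beta> e t = vector [vector [1, 0, 0, 1],
                  vector [0, 1, -1, 0],
                  vector [0, -1, 1 - (1 + \<alpha> + 3 * \<beta>) / (1 + e * cos t), 0],
                  vector [1, 0, 0, 1 - (1 + \<alpha> - 3 * \<beta>) / (1 + e * cos t)]]"

definition fundamental_solution :: "real \<Rightarrow> real \<Rightarrow> real \<Rightarrow> (real \<Rightarrow> real^4^4) \<Rightarrow> bool" where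
  "fundamental_solution \<alpha> \<beta> e \<xi> \<longleftrightarrow>
     \<xi> 0 = mat 1 \<and>
     (\<forall>t\<in>{0..2*pi}. (\<xi> has_vector_derivative (Jmat ** Bmat \<alpha> \<beta> e t ** \<xi> t)) (at t within {0..2*pi}))"

definition nu1 :: "real^4^4 \<Rightarrow> nat" where
  "nu1 M = dim {v :: real^4. (M - mat 1) *v v = 0}"

text \<open>Tilde coordinates: alpha~ = alpha - beta, beta~ = -alpha + 3 beta - 1, inverted.\<close>
definition alpha_of_tilde :: "real \<Rightarrow> real \<Rightarrow> real" where
  "alpha_of_tilde a b = (3 * a + b + 1) / 2"
definition beta_of_tilde :: "real \<Rightarrow> real \<Rightarrow> real" where
  "beta_of_tilde a b = (a + b + 1) / 2"

definition R_NH :: "(real \<times> real \<times> real) set" where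
  "R_NH = {(a, b, e). -1 < b \<and> b < 0 \<and> a > 0 \<and> 0 \<le> e \<and> e < 1}"
definition R_EH :: "(real \<times> real \<times> real) set" where
  "R_EH = {(a, b, e). b > 0 \<and> a > 0 \<and> 0 \<le> e \<and> e < 1}"

end

theory Submission
  imports Defs
begin

text \<open>
  In the coordinates $x = q_1$, $y = q_2$, $u = x' - 2y$, $w = y' + 2x$ the system reads
  $(1 + e \cos t)\, u' = a x$, $(1 + e \cos t)\, w' = b y$ with $a = 1 + \alpha + 3\beta$ and
  $b = 1 + \alpha - 3\beta$, both nonzero in the two regions. For a $2\pi$-periodic solution the Fourier
  coefficients $F_n = i n u_n$ of $u'$ satisfy $a x_n = F_n + \frac{e}{2}(F_{n-1} + F_{n+1})$, and likewise
  for $y, w$. Since $F_0 = 0$, the equations for $n > 0$ do not involve the modes $n \le 0$: the positive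
  modes, completed by a suitable constant term, again form a periodic solution. Hence a Hilbert
  transform (twice the imaginary part of the positive part) acts on the real periodic solutions.
  It squares to $-1$, so it is a complex structure on the kernel, whose dimension must be even.
\<close>

subsection \<open>Fourier coefficients\<close>

text \<open>The completing constant of the positive part of x is forced by mode 0: with F_{-1}
  dropped, a x_0 = (e/2) F_1 must be solved for x_0, and likewise for y with b. This is where a and
  b have to be nonzero. The square is -1 for the following reason. A real solution equals twice the
  real part of its positive part at t = 0: their difference is a solution with mode 0 only, and then
  a x_0 = b y_0 = 0 leaves nothing. The transform multiplies the positive part by -\<i>, so applying
  it twice gives 2 Im (-\<i> P) = -2 Re P. The analytic obstacle is that a truncated Fourier series
  must again be differentiable, which needs absolute summability of n u_n over n > 0. This follows
  from diagonal dominance of the recurrence: the middle weight 1 exceeds the total weight e of the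
  neighbours. Completeness of the Fourier system is replaced by a weaker fact. Solutions are
  determined by their initial vectors, so it is enough that vanishing coefficients force the value 0
  at t = 0, and Bessel's inequality gives that.\<close>

definition fourier :: "(real \<Rightarrow> complex) \<Rightarrow> int \<Rightarrow> complex" where
  "fourier f n = integral {0..2 * pi} (\<lambda>t. f t * cis (- (of_int n * t))) / (2 * pi)"

text \<open>Only modes n >= 0 occur because this is the shape of a positive part. The sum is
  meaningful under absolute summability, which the lemmas on its analytic behaviour assume.\<close>

definition trig_series :: "(nat \<Rightarrow> complex) \<Rightarrow> real \<Rightarrow> complex" where
  "trig_series c t = (\<Sum>n. c n * cis (real n * t))"

lemma fourier_cong:
  assumes "\<And>t. t \<in> {0..2 * pi} \<Longrightarrow> f t = g t"
  shows "fourier f n = fourier g n"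
  proof -
  have "integral {0..2 * pi} (\<lambda>t. f t * cis (- (of_int n * t)))
      = integral {0..2 * pi} (\<lambda>t. g t * cis (- (of_int n * t)))"
    by (rule integral_cong) (simp add: assms)
  then show ?thesis by (simp add: fourier_def)
qed

lemma fourier_integrable:
  assumes "continuous_on {0..2 * pi} f"
  shows "(\<lambda>t. f t * cis (- (of_int n * t))) integrable_on {0..2 * pi}"
  by (intro integrable_continuous_real continuous_intros assms)

lemma fourier_add:
  assumes "continuous_on {0..2 * pi} f" "continuous_on {0..2 * pi} g"
  shows "fourier (\<lambda>t. f t + g t) n = fourier f n + fourier g n"
  unfolding fourier_def
  using integral_add[OF fourier_integrable[OF assms(1)] fourier_integrable[OF assms(2)]]
  by (simp add: distrib_right add_divide_distrib)

lemma fourier_cmult: "fourier (\<lambda>t. c * f t) n = c * fourier f n"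
  unfolding fourier_def by (simp add: mult.assoc)

lemma fourier_diff:
  assumes "continuous_on {0..2 * pi} f" "continuous_on {0..2 * pi} g"
  shows "fourier (\<lambda>t. f t - g t) n = fourier f n - fourier g n"
  unfolding fourier_def
  using integral_diff[OF fourier_integrable[OF assms(1)] fourier_integrable[OF assms(2)]]
  by (simp add: left_diff_distrib diff_divide_distrib)

lemma fourier_cnj: "fourier (\<lambda>t. cnj (f t)) n = cnj (fourier f (- n))"
  unfolding fourier_def by (simp add: integral_cnj cis_cnj)

lemma fourier_shift: "fourier (\<lambda>t. cis (of_int m * t) * f t) n = fourier f (n - m)"
proof -
  have "cis (of_int m * t) * f t * cis (- (of_int n * t)) = f t * cis (- (of_int (n - m) * t))" for t
  proof -
    have "cis (of_int m * t) * f t * cis (- (of_int n * t))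
        = f t * (cis (of_int m * t) * cis (- (of_int n * t)))" by (simp add: mult_ac)
    then show ?thesis by (simp add: cis_mult algebra_simps)
  qed
  then show ?thesis by (simp only: fourier_def)
qed

lemma fourier_cos:
  assumes "continuous_on {0..2 * pi} f"
  shows "fourier (\<lambda>t. of_real (cos t) * f t) n = (fourier f (n - 1) + fourier f (n + 1)) / 2"
proof -
  have "cis t + cis (- t) = 2 * of_real (cos t)" for t
    by (simp add: complex_eq_iff)
  then have "(1/2) * ((cis t + cis (- t)) * f t) = of_real (cos t) * f t" for t
    by simp
  then have "of_real (cos t) * f t = (1/2) * (cis (of_int 1 * t) * f t + cis (of_int (-1) * t) * f t)" for t
    by (simp add: distrib_right)
  then have "fourier (\<lambda>t. of_real (cos t) * f t) n
    = fourier (\<lambda>t. (1/2) * (cis (of_int 1 * t) * f t + cis (of_int (-1) * t) * f t)) n" by (simp only:)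
  also have "\<dots> = (1/2) * (fourier f (n - 1) + fourier f (n - (-1)))"
    unfolding fourier_cmult
    by (subst fourier_add) (use assms in \<open>auto simp only: fourier_shift intro!: continuous_intros\<close>)
  finally show ?thesis by simp
qed

lemma fourier_bound:
  assumes "continuous_on {0..2 * pi} f" "\<And>t. t \<in> {0..2 * pi} \<Longrightarrow> norm (f t) \<le> B"
  shows "norm (fourier f n) \<le> B"
proof -
  have "norm (integral {0..2 * pi} (\<lambda>t. f t * cis (- (of_int n * t)))) \<le> B * (2 * pi - 0)"
    by (rule integral_bound) (use assms in \<open>auto simp: norm_mult intro!: continuous_intros\<close>)
  then show ?thesis by (simp add: fourier_def norm_divide field_simps norm_mult)
qed

lemma fourier_bounded:
  assumes "continuous_on {0..2 * pi} f"
  obtains B where "\<And>n. norm (fourier f n) \<le> B"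
proof -
  have "bounded (f ` {0..2 * pi})"
    using assms by (intro compact_imp_bounded compact_continuous_image) auto
  then obtain B where "\<forall>z\<in>f ` {0..2 * pi}. norm z \<le> B"
    unfolding bounded_iff by (rule exE)
  then have "\<And>t. t \<in> {0..2 * pi} \<Longrightarrow> norm (f t) \<le> B" by blast
  then show ?thesis using fourier_bound[OF assms] that by blast
qed

lemma cis_int_2pi: "cis (- (of_int n * (2 * pi))) = 1"
proof -
  have "- (of_int n * (2 * pi)) = 2 * pi * of_int (- n)" by simp
  then show ?thesis by (metis Ints_of_int cis_multiple_2pi)
qed

lemma has_vector_derivative_cis_mult:
  "((\<lambda>t. cis (r * t)) has_vector_derivative \<i> * of_real r * cis (r * t)) (at t within A)"
proof -
  have "((\<lambda>t. cis (r * t)) has_derivative (\<lambda>h. (r * h) *\<^sub>R (\<i> * cis (r * t)))) (at t within A)"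
    by (intro has_derivative_cis has_derivative_mult_right has_derivative_ident)
  then show ?thesis
    by (simp add: has_vector_derivative_def scaleR_conv_of_real mult_ac)
qed

lemma fourier_deriv:
  assumes "\<And>t. t \<in> {0..2 * pi} \<Longrightarrow> (f has_vector_derivative f' t) (at t within {0..2 * pi})"
    and "continuous_on {0..2 * pi} f'" "f (2 * pi) = f 0"
  shows "fourier f' n = \<i> * of_int n * fourier f n"
proof -
  let ?e = "\<lambda>t. cis (- (of_int n * t))"
  have f: "continuous_on {0..2 * pi} f"
    unfolding continuous_on_eq_continuous_within
    by (intro ballI) (rule has_vector_derivative_continuous[OF assms(1)])
  have "((\<lambda>t. f t * ?e t) has_vector_derivative
      (f' t * ?e t - \<i> * of_int n * (f t * ?e t))) (at t within {0..2 * pi})"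
    if "t \<in> {0..2 * pi}" for t
  proof -
    have "(?e has_vector_derivative - \<i> * of_int n * ?e t) (at t within {0..2 * pi})"
      using has_vector_derivative_cis_mult[of "- of_int n" t] by simp
    from has_vector_derivative_mult[OF assms(1)[OF that] this]
    show ?thesis by (simp add: algebra_simps)
  qed
  then have "((\<lambda>t. f' t * ?e t - \<i> * of_int n * (f t * ?e t)) has_integral
      f (2 * pi) * ?e (2 * pi) - f 0 * ?e 0) {0..2 * pi}"
    by (intro fundamental_theorem_of_calculus) simp_all
  then have "integral {0..2 * pi} (\<lambda>t. f' t * ?e t - \<i> * of_int n * (f t * ?e t)) = 0"
    by (simp add: assms(3) cis_int_2pi integral_unique)
  moreover have "integral {0..2 * pi} (\<lambda>t. f' t * ?e t - \<i> * of_int n * (f t * ?e t))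
      = integral {0..2 * pi} (\<lambda>t. f' t * ?e t) - integral {0..2 * pi} (\<lambda>t. \<i> * of_int n * (f t * ?e t))"
    by (rule integral_diff[OF fourier_integrable[OF assms(2)] integrable_on_mult_right[OF fourier_integrable[OF f]]])
  ultimately show ?thesis by (simp add: fourier_def)
qed

section \<open>Orthogonality of the exponentials and Bessel's inequality\<close>

lemma fourier_1: "fourier (\<lambda>t. 1) n = (if n = 0 then 1 else 0)"
proof (cases "n = 0")
  case True
  then show ?thesis by (simp add: fourier_def scaleR_conv_of_real)
next
  case False
  have "fourier (\<lambda>t. 0) n = \<i> * of_int n * fourier (\<lambda>t. 1) n"
    by (rule fourier_deriv) auto
  moreover have "fourier (\<lambda>t. 0) n = 0" by (simp add: fourier_def)
  ultimately show ?thesis using False by simp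
qed

lemma fourier_cis: "fourier (\<lambda>t. cis (of_int m * t)) n = (if n = m then 1 else 0)"
  using fourier_shift[of m "\<lambda>t. 1" n] by (simp add: fourier_1)

lemma fourier_sum:
  assumes "finite A" "\<And>k. k \<in> A \<Longrightarrow> continuous_on {0..2 * pi} (f k)"
  shows "fourier (\<lambda>t. \<Sum>k\<in>A. f k t) n = (\<Sum>k\<in>A. fourier (f k) n)"
  using assms
proof (induction A rule: finite_induct)
  case empty
  then show ?case by (simp add: fourier_def)
next
  case (insert x F)
  have "fourier (\<lambda>t. f x t + (\<Sum>k\<in>F. f k t)) n = fourier (f x) n + fourier (\<lambda>t. \<Sum>k\<in>F. f k t) n"
    by (intro fourier_add continuous_on_sum) (use insert.prems in auto)
  then show ?case using insert by simp
qed

text \<open>Finite Bessel inequality: removing the modes \<sigma> 0, ..., \<sigma> (N - 1) from g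
  lowers its mean square by N |a|^2, yet the result stays nonnegative for every N. A general
  injective \<sigma> lets the same lemma serve the nonnegative and the negative modes.\<close>

lemma fourier_constant_imp_0:
  assumes g: "continuous_on {0..2 * pi} g" and inj: "inj (\<sigma> :: nat \<Rightarrow> int)"
    and a: "\<And>k. fourier g (\<sigma> k) = a"
  shows "a = 0"
proof (rule ccontr)
  assume "a \<noteq> 0"
  define c where "c k t = cis (of_int (\<sigma> k) * t)" for k t
  define R where "R N t = g t - a * (\<Sum>k<N. c k t)" for N t
  have c [continuous_intros]: "continuous_on {0..2 * pi} (c k)" for k
    unfolding c_def by (intro continuous_intros)
  have R [continuous_intros]: "continuous_on {0..2 * pi} (R N)" for N
    unfolding R_def by (intro continuous_intros g)
  have fR: "fourier (R N) (\<sigma> N) = a" for N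
  proof -
    have "fourier (R N) (\<sigma> N) = fourier g (\<sigma> N) - a * (\<Sum>k<N. fourier (c k) (\<sigma> N))"
      unfolding R_def
      by (subst fourier_diff, rule g, (intro continuous_intros)[],
          subst fourier_cmult, subst fourier_sum) (auto intro: c)
    also have "(\<Sum>k<N. fourier (c k) (\<sigma> N)) = (\<Sum>k<N. 0)"
      by (rule sum.cong) (use inj in \<open>auto simp: c_def[abs_def] fourier_cis inj_eq\<close>)
    finally show ?thesis by (simp add: a)
  qed
  \<comment> \<open>The mean square of the remainder, written as a zero mode so that the linearity
    rules for \<open>fourier\<close> compute it.\<close>
  define Q where "Q N = Re (fourier (\<lambda>t. R N t * cnj (R N t)) 0)" for N
  have Q: "Q N = Q 0 - real N * (norm a)\<^sup>2" for N
  proof (induction N)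
    case (Suc N)
    \<comment> \<open>The zero mode of \<open>?h\<close> is the coefficient of \<open>R N\<close> at
      \<sigma> N, which is still a because that mode has not been subtracted yet.\<close>
    let ?f = "\<lambda>t. R N t * cnj (R N t)" and ?h = "\<lambda>t. cis (of_int (- \<sigma> N) * t) * R N t"
    have "R (Suc N) t * cnj (R (Suc N) t)
        = (?f t - cnj a * ?h t) - a * cnj (?h t) + a * cnj a * 1" for t
    proof -
      have RS: "R (Suc N) t = R N t - a * c N t" by (simp add: R_def algebra_simps)
      have 1: "c N t * cnj (c N t) = 1" by (simp add: c_def cis_cnj cis_mult)
      have 2: "?h t = cnj (c N t) * R N t" by (simp add: c_def cis_cnj)
      have "R (Suc N) t * cnj (R (Suc N) t)
        = (?f t - cnj a * ?h t) - a * cnj (?h t) + a * cnj a * (c N t * cnj (c N t))"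
        unfolding RS 2 by (simp add: algebra_simps)
      then show ?thesis using 1 by simp
    qed
    then have "fourier (\<lambda>t. R (Suc N) t * cnj (R (Suc N) t)) 0
       = fourier (\<lambda>t. (?f t - cnj a * ?h t) - a * cnj (?h t) + a * cnj a * 1) 0"
      by presburger
    also have "\<dots> = fourier ?f 0 - cnj a * fourier ?h 0 - a * cnj (fourier ?h 0) + a * cnj a"
    proof -
      have "fourier (\<lambda>t. (?f t - cnj a * ?h t) - a * cnj (?h t) + a * cnj a * 1) 0
          = fourier (\<lambda>t. (?f t - cnj a * ?h t) - a * cnj (?h t)) 0 + fourier (\<lambda>t. a * cnj a * 1) 0"
        by (intro fourier_add continuous_intros)
      also have "fourier (\<lambda>t. (?f t - cnj a * ?h t) - a * cnj (?h t)) 0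
          = fourier (\<lambda>t. ?f t - cnj a * ?h t) 0 - fourier (\<lambda>t. a * cnj (?h t)) 0"
        by (intro fourier_diff continuous_intros)
      also have "fourier (\<lambda>t. ?f t - cnj a * ?h t) 0 = fourier ?f 0 - fourier (\<lambda>t. cnj a * ?h t) 0"
        by (intro fourier_diff continuous_intros)
      also have "fourier (\<lambda>t. cnj a * ?h t) 0 = cnj a * fourier ?h 0"
        by (rule fourier_cmult)
      also have "fourier (\<lambda>t. a * cnj (?h t)) 0 = a * cnj (fourier ?h 0)"
        unfolding fourier_cmult fourier_cnj by simp
      also have "fourier (\<lambda>t. a * cnj a * 1) 0 = a * cnj a"
        unfolding fourier_cmult fourier_1 by simp
      finally show ?thesis .
    qed
    also have "fourier ?h 0 = a" unfolding fourier_shift using fR by simp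
    also have "fourier ?f 0 - cnj a * a - a * cnj a + a * cnj a = fourier ?f 0 - of_real ((norm a)\<^sup>2)"
      by (simp only: complex_norm_square) (simp add: algebra_simps)
    finally have "Q (Suc N) = Q N - (norm a)\<^sup>2" by (simp add: Q_def)
    then show ?case using Suc by (simp add: algebra_simps)
  qed simp
  have Q_nonneg: "0 \<le> Q N" for N
  proof -
    have "0 \<le> integral {0..2 * pi} (\<lambda>t. (norm (R N t))\<^sup>2)"
      by (rule integral_nonneg) (auto intro!: integrable_continuous_real continuous_intros)
    moreover have "integral {0..2 * pi} (\<lambda>t. R N t * cnj (R N t))
        = of_real (integral {0..2 * pi} (\<lambda>t. (norm (R N t))\<^sup>2))"
    proof -
      have "((\<lambda>t. (norm (R N t))\<^sup>2) has_integral integral {0..2 * pi} (\<lambda>t. (norm (R N t))\<^sup>2)) {0..2 * pi}"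
        by (intro integrable_integral integrable_continuous_real continuous_intros)
      from has_integral_linear[OF this bounded_linear_of_real]
      have "((\<lambda>t. R N t * cnj (R N t)) has_integral of_real (integral {0..2 * pi} (\<lambda>t. (norm (R N t))\<^sup>2))) {0..2 * pi}"
        by (simp add: o_def complex_norm_square[symmetric])
      then show ?thesis by (rule integral_unique)
    qed
    ultimately show ?thesis by (simp add: Q_def fourier_def)
  qed
  obtain N where "Q 0 < real N * (norm a)\<^sup>2"
    using reals_Archimedean3[of "(norm a)\<^sup>2"] \<open>a \<noteq> 0\<close> by (metis zero_less_norm_iff zero_less_power)
  then show False using Q_nonneg[of N] unfolding Q[of N] by linarith
qed

section \<open>From vanishing coefficients to a vanishing value at the endpoint\<close>

lemma has_vector_derivative_quotient_tendsto:
  assumes "(f has_vector_derivative D) (at a within S)"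
  shows "((\<lambda>t. (f t - f a) /\<^sub>R (t - a)) \<longlongrightarrow> D) (at a within S)"
proof -
  have "((\<lambda>t. norm ((f t - f a) - (t - a) *\<^sub>R D) / norm (t - a)) \<longlongrightarrow> 0) (at a within S)"
    using assms by (simp add: has_vector_derivative_def has_derivative_iff_norm)
  moreover have "norm ((f t - f a) - (t - a) *\<^sub>R D) / norm (t - a)
      = norm ((f t - f a) /\<^sub>R (t - a) - D)" if "t \<noteq> a" for t
  proof -
    have "(f t - f a) /\<^sub>R (t - a) - D = ((f t - f a) - (t - a) *\<^sub>R D) /\<^sub>R (t - a)"
      using that by (simp add: scaleR_diff_right)
    then show ?thesis by (simp add: divide_inverse mult.commute)
  qed
  then have "\<forall>\<^sub>F t in at a within S. norm ((f t - f a) - (t - a) *\<^sub>R D) / norm (t - a)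
      = norm ((f t - f a) /\<^sub>R (t - a) - D)"
    by (auto simp: eventually_at_filter)
  ultimately have "((\<lambda>t. norm ((f t - f a) /\<^sub>R (t - a) - D)) \<longlongrightarrow> 0) (at a within S)"
    by (rule Lim_transform_eventually)
  then show ?thesis
    using Lim_null tendsto_norm_zero_iff by blast
qed

text \<open>L'Hopital's rule in the one form required: divide numerator and denominator by t - a. It
  supplies the endpoint values of the quotient by \<open>cis t - 1\<close> used below.\<close>

lemma cis_minus_1_quotient_tendsto:
  assumes "(f has_vector_derivative f') (at a within S)" "cis a = 1"
  shows "((\<lambda>t. (f t - f a) / (cis t - 1)) \<longlongrightarrow> f' / \<i>) (at a within S)"
proof -
  have "(cis has_vector_derivative \<i>) (at a within S)"
    using has_vector_derivative_cis_mult[of 1 a S] assms(2) by simp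
  from has_vector_derivative_quotient_tendsto[OF this]
  have "((\<lambda>t. ((f t - f a) /\<^sub>R (t - a)) / ((cis t - 1) /\<^sub>R (t - a))) \<longlongrightarrow> f' / \<i>) (at a within S)"
    using assms(2) by (intro tendsto_divide has_vector_derivative_quotient_tendsto assms) auto
  moreover have "\<forall>\<^sub>F t in at a within S. ((f t - f a) /\<^sub>R (t - a)) / ((cis t - 1) /\<^sub>R (t - a))
      = (f t - f a) / (cis t - 1)"
    by (auto simp: eventually_at_filter scaleR_conv_of_real)
  ultimately show ?thesis by (rule Lim_transform_eventually)
qed

text \<open>
  Writing $f - f(0) = (e^{it} - 1) g$ with $g$ continuous, the hypothesis says that the coefficients of
  $g$ are constant on $n \ge 0$ and on $n < 0$, hence zero by Bessel's inequality; but their jump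
  at $0$ is $f(0)$.
\<close>

lemma fourier_eq_0_imp_0:
  assumes f: "continuous_on {0..2 * pi} f" and per: "f (2 * pi) = f 0"
    and d0: "(f has_vector_derivative f0) (at 0 within {0..2 * pi})"
    and d1: "(f has_vector_derivative f1) (at (2 * pi) within {0..2 * pi})"
    and z: "\<And>n. fourier f n = 0"
  shows "f 0 = 0"
proof -
  \<comment> \<open>The denominator vanishes at both ends of the interval; the values put there are
    the one-sided limits, so that g becomes continuous.\<close>
  define g where "g t = (if t = 0 then f0 / \<i> else if t = 2 * pi then f1 / \<i> else (f t - f 0) / (cis t - 1))" for t
  have cis_ne: "cis t \<noteq> 1" if "0 < t" "t < 2 * pi" for t
  proof
    assume "cis t = 1"
    then have "cos t = 1" by (metis cis.simps(1) one_complex.simps(1))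
    then obtain k :: int where k: "t = of_int k * 2 * pi" using cos_one_2pi_int by blast
    with that have "0 < k" "k < 1" by (auto simp: zero_less_mult_iff)
    then show False by simp
  qed
  have g: "continuous_on {0..2 * pi} g"
    unfolding continuous_on_eq_continuous_within continuous_within
  proof
    fix t :: real assume t: "t \<in> {0..2 * pi}"
    consider "t = 0" | "t = 2 * pi" | "0 < t" "t < 2 * pi" using t by force
    then show "(g \<longlongrightarrow> g t) (at t within {0..2 * pi})"
    proof cases
      case 1
      have "\<forall>\<^sub>F s in at 0 within {0..2 * pi}. (f s - f 0) / (cis s - 1) = g s"
        unfolding eventually_at using pi_gt_zero
        by (intro exI[of _ pi]) (auto simp: g_def dist_real_def)
      from Lim_transform_eventually[OF cis_minus_1_quotient_tendsto[OF d0 cis_zero] this]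
      show ?thesis unfolding 1 by (simp only: g_def[of 0] if_True simp_thms)
    next
      case 2
      have "\<forall>\<^sub>F s in at (2 * pi) within {0..2 * pi}. (f s - f (2 * pi)) / (cis s - 1) = g s"
        unfolding eventually_at using pi_gt_zero
        by (intro exI[of _ pi]) (auto simp: g_def dist_real_def per)
      from Lim_transform_eventually[OF cis_minus_1_quotient_tendsto[OF d1 cis_2pi] this]
      show ?thesis unfolding 2 using pi_gt_zero by (simp only: g_def[of "2 * pi"] if_True) simp
    next
      case 3
      have "((\<lambda>t. (f t - f 0) / (cis t - 1)) \<longlongrightarrow> (f t - f 0) / (cis t - 1)) (at t within {0..2 * pi})"
        using f t cis_ne[OF 3]
        by (intro tendsto_intros) (auto simp: continuous_on_def)
      moreover have "\<forall>\<^sub>F s in at t within {0..2 * pi}. (f s - f 0) / (cis s - 1) = g s"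
        unfolding eventually_at using 3
        by (intro exI[of _ "min t (2 * pi - t)"]) (auto simp: g_def dist_real_def)
      ultimately show ?thesis using 3 by (auto simp: g_def intro: Lim_transform_eventually)
    qed
  qed
  have "fourier f n - f 0 * fourier (\<lambda>t. 1) n = fourier g (n - 1) - fourier g n" for n
  proof -
    have "fourier (\<lambda>t. cis (of_int 1 * t) * g t - g t) n = fourier (\<lambda>t. f t - f 0 * 1) n"
    proof (rule fourier_cong)
      fix t :: real assume "t \<in> {0..2 * pi}"
      then consider "t = 0" | "t = 2 * pi" | "0 < t" "t < 2 * pi" by force
      then show "cis (of_int 1 * t) * g t - g t = f t - f 0 * 1"
      proof cases
        case 3
        then have "g t = (f t - f 0) / (cis t - 1)" by (simp add: g_def)
        then have "(cis t - 1) * g t = f t - f 0" using cis_ne[OF 3] by simp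
        then show ?thesis by (simp add: left_diff_distrib)
      qed (auto simp: per)
    qed
    also have "fourier (\<lambda>t. f t - f 0 * 1) n = fourier f n - fourier (\<lambda>t. f 0 * 1) n"
      by (intro fourier_diff continuous_intros f)
    also have "fourier (\<lambda>t. cis (of_int 1 * t) * g t - g t) n
        = fourier (\<lambda>t. cis (of_int 1 * t) * g t) n - fourier g n"
      by (intro fourier_diff continuous_intros g)
    finally show ?thesis by (simp only: fourier_cmult fourier_shift)
  qed
  from this[symmetric] have step: "fourier g (n - 1) - fourier g n = (if n = 0 then - f 0 else 0)" for n
    by (simp add: fourier_1 z)
  have pos: "fourier g (int k) = fourier g 0" for k
  proof (induction k)
    case (Suc k)
    then show ?case using step[of "int (Suc k)"] by simp
  qed simp
  have neg: "fourier g (- 1 - int k) = fourier g (- 1)" for k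
  proof (induction k)
    case (Suc k)
    then show ?case using step[of "- 1 - int k"] by (simp add: algebra_simps)
  qed simp
  have "fourier g 0 = 0"
    by (rule fourier_constant_imp_0[OF g _ pos]) (auto simp: inj_def)
  moreover have "fourier g (-1) = 0"
    by (rule fourier_constant_imp_0[OF g _ neg]) (auto simp: inj_def)
  ultimately show ?thesis using step[of 0] by simp
qed

subsection \<open>One-sided trigonometric series\<close>

lemma trig_series_summable:
  assumes "summable (\<lambda>n. norm (c n))"
  shows "summable (\<lambda>n. c n * cis (real n * t))"
  by (rule summable_norm_cancel) (use assms in \<open>simp add: norm_mult\<close>)

lemma trig_series_uniform_limit:
  assumes "summable (\<lambda>n. norm (c n))"
  shows "uniform_limit A (\<lambda>N t. \<Sum>n<N. c n * cis (real n * t)) (trig_series c) sequentially"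
  unfolding trig_series_def[abs_def]
  by (rule Weierstrass_m_test[OF _ assms]) (simp add: norm_mult)

lemma trig_series_add:
  assumes "summable (\<lambda>n. norm (c n))" "summable (\<lambda>n. norm (d n))"
  shows "trig_series (\<lambda>n. c n + d n) t = trig_series c t + trig_series d t"
  unfolding trig_series_def distrib_right
  by (rule suminf_add[symmetric]; intro trig_series_summable assms)

lemma trig_series_cmult:
  assumes "summable (\<lambda>n. norm (c n))"
  shows "trig_series (\<lambda>n. a * c n) t = a * trig_series c t"
  unfolding trig_series_def mult.assoc
  by (rule suminf_mult; intro trig_series_summable assms)

lemma trig_series_2pi: "trig_series c (2 * pi) = trig_series c 0"
proof -
  have "cis (real n * (2 * pi)) = 1" for n
    using cis_int_2pi[of "- int n"] by simp
  then show ?thesis by (simp add: trig_series_def)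
qed

lemma fourier_trig_series:
  assumes c: "summable (\<lambda>n. norm (c n))"
  shows "fourier (trig_series c) n = (if n \<ge> 0 then c (nat n) else 0)"
proof -
  let ?s = "\<lambda>N t. \<Sum>k<N. c k * cis (of_int (int k) * t)"
  have "uniform_limit {0..2 * pi} (\<lambda>N t. ?s N t * cis (- (of_int n * t)))
      (\<lambda>t. trig_series c t * cis (- (of_int n * t))) sequentially"
    unfolding uniform_limit_iff
  proof (intro allI impI)
    fix e :: real assume "e > 0"
    with trig_series_uniform_limit[OF c, of "{0..2 * pi}"]
    have "\<forall>\<^sub>F N in sequentially. \<forall>t\<in>{0..2 * pi}. dist (\<Sum>n<N. c n * cis (real n * t)) (trig_series c t) < e"
      by (auto simp: uniform_limit_iff)
    then show "\<forall>\<^sub>F N in sequentially. \<forall>t\<in>{0..2 * pi}. dist (?s N t * cis (- (of_int n * t)))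
        (trig_series c t * cis (- (of_int n * t))) < e"
      by eventually_elim (simp add: dist_norm left_diff_distrib[symmetric] norm_mult)
  qed
  then obtain I J where I: "\<And>N. ((\<lambda>t. ?s N t * cis (- (of_int n * t))) has_integral I N) {0..2 * pi}"
    and J: "((\<lambda>t. trig_series c t * cis (- (of_int n * t))) has_integral J) {0..2 * pi}"
    and lim: "I \<longlonglongrightarrow> J"
    by (rule uniform_limit_integral) (auto intro!: continuous_intros)
  \<comment> \<open>Once N exceeds n the partial sum already contains mode n, so the sequence is
    eventually constant. For negative n every partial sum gives 0.\<close>
  have IN: "I N / (2 * pi) = (if n \<ge> 0 then c (nat n) else 0)" if "N > nat n" for N
  proof -
    have "I N / (2 * pi) = fourier (?s N) n"
      using integral_unique[OF I[of N]] by (simp add: fourier_def)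
    also have "\<dots> = (\<Sum>k<N. c k * (if n = int k then 1 else 0))"
      by (subst fourier_sum) (auto simp del: of_int_of_nat_eq simp: fourier_cmult fourier_cis intro!: continuous_intros)
    also have "\<dots> = (\<Sum>k<N. if k = nat n \<and> n \<ge> 0 then c k else 0)"
      by (rule sum.cong) auto
    also have "\<dots> = (if n \<ge> 0 then c (nat n) else 0)"
      using that by (cases "n \<ge> 0") (auto simp: sum.delta)
    finally show ?thesis .
  qed
  have "(\<lambda>N. I N / (2 * pi)) \<longlonglongrightarrow> J / (2 * pi)"
    by (intro tendsto_intros lim) auto
  moreover have "(\<lambda>N. I N / (2 * pi)) \<longlonglongrightarrow> (if n \<ge> 0 then c (nat n) else 0)"
    by (rule tendsto_eventually)
       (rule eventually_mono[OF eventually_gt_at_top[of "nat n"] IN])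
  ultimately have "J / (2 * pi) = (if n \<ge> 0 then c (nat n) else 0)"
    using LIMSEQ_unique by blast
  then show ?thesis using integral_unique[OF J] by (simp add: fourier_def)
qed

lemma trig_series_has_vector_derivative:
  assumes c: "summable (\<lambda>n. norm (c n))" and nc: "summable (\<lambda>n. norm (\<i> * of_nat n * c n))"
  shows "(trig_series c has_vector_derivative trig_series (\<lambda>n. \<i> * of_nat n * c n) t) (at t within A)"
proof -
  let ?d = "\<lambda>n. \<i> * of_nat n * c n"
  have "\<exists>g. \<forall>x\<in>UNIV. (\<lambda>n. c n * cis (real n * x)) sums g x
      \<and> (g has_derivative (\<lambda>h. h *\<^sub>R trig_series ?d x)) (at x within UNIV)"
  proof (rule has_derivative_series)
    show "((\<lambda>x. c n * cis (real n * x)) has_derivative (\<lambda>h. h *\<^sub>R (?d n * cis (real n * x)))) (at x within UNIV)"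
      for n x
      using has_derivative_mult_right[OF has_vector_derivative_cis_mult[of "real n" x, unfolded has_vector_derivative_def], of "c n"]
      by (simp add: scaleR_conv_of_real mult_ac)
    show "\<forall>\<^sub>F n in sequentially. \<forall>x\<in>UNIV. \<forall>h.
       norm ((\<Sum>i<n. h *\<^sub>R (?d i * cis (real i * x))) - h *\<^sub>R trig_series ?d x) \<le> e * norm h"
      if "e > 0" for e
    proof -
      have "\<forall>\<^sub>F n in sequentially. \<forall>x\<in>UNIV. dist (\<Sum>i<n. ?d i * cis (real i * x)) (trig_series ?d x) < e"
        using trig_series_uniform_limit[OF nc, of UNIV] \<open>e > 0\<close> by (simp add: uniform_limit_iff)
      then show ?thesis
      proof eventually_elim
        case (elim n)
        show ?case
        proof (intro ballI allI)
          fix x h :: real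
          have "(\<Sum>i<n. h *\<^sub>R (?d i * cis (real i * x))) - h *\<^sub>R trig_series ?d x
              = h *\<^sub>R ((\<Sum>i<n. ?d i * cis (real i * x)) - trig_series ?d x)"
            by (simp add: scaleR_sum_right scaleR_diff_right)
          moreover have "norm ((\<Sum>i<n. ?d i * cis (real i * x)) - trig_series ?d x) \<le> e"
            using elim by (auto simp: dist_norm intro: less_imp_le)
          from mult_left_mono[OF this abs_ge_zero[of h]]
          have "norm (h *\<^sub>R ((\<Sum>i<n. ?d i * cis (real i * x)) - trig_series ?d x)) \<le> e * norm h"
            by (simp add: mult.commute)
          ultimately show "norm ((\<Sum>i<n. h *\<^sub>R (?d i * cis (real i * x))) - h *\<^sub>R trig_series ?d x) \<le> e * norm h"
            by presburger
        qed
      qed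
    qed
    show "(\<lambda>n. c n * cis (real n * 0)) sums (\<Sum>n. c n * cis (real n * 0))"
      by (intro summable_sums trig_series_summable c)
  qed auto
  then obtain g where g: "\<And>x. (\<lambda>n. c n * cis (real n * x)) sums g x"
    "\<And>x. (g has_derivative (\<lambda>h. h *\<^sub>R trig_series ?d x)) (at x)" by auto
  have "g = trig_series c"
    using g(1) by (auto simp: fun_eq_iff trig_series_def sums_iff)
  then show ?thesis
    using g(2)[of t] by (simp add: has_vector_derivative_def has_derivative_at_withinI)
qed

lemma cis_Suc_mult: "cis (real (Suc n) * t) = cis t * cis (real n * t)"
  by (simp add: cis_mult distrib_right)

text \<open>The cosine is the mean of the shifts by \<open>cis t\<close> and
  \<open>cis (- t)\<close>. The downward shift would create a mode -1 out of \<open>c 0\<close>; its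
  vanishing keeps the product one-sided.\<close>

lemma trig_series_mult_cos:
  assumes c: "summable (\<lambda>n. norm (c n))" and c0: "c 0 = 0"
  shows "(1 + of_real e * of_real (cos t)) * trig_series c t
    = trig_series (\<lambda>n. c n + of_real e / 2 * (c (Suc n) + (if n = 0 then 0 else c (n - 1)))) t"
    and "summable (\<lambda>n. norm (c n + of_real e / 2 * (c (Suc n) + (if n = 0 then 0 else c (n - 1)))))"
proof -
  define d where "d n = (if n = 0 then 0 else c (n - 1))" for n
  have c1: "summable (\<lambda>n. norm (c (Suc n)))"
    using c by (subst summable_Suc_iff)
  have d: "summable (\<lambda>n. norm (d n))"
    using c by (subst summable_Suc_iff[symmetric]) (simp add: d_def)
  have s: "summable (\<lambda>n. norm (c (Suc n) + d n))"
    by (rule summable_comparison_test'[OF summable_add[OF c1 d]]) (simp add: norm_triangle_ineq)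
  have s': "summable (\<lambda>n. norm (of_real e / 2 * (c (Suc n) + d n)))"
    unfolding norm_mult by (intro summable_mult s)
  show "summable (\<lambda>n. norm (c n + of_real e / 2 * (c (Suc n) + (if n = 0 then 0 else c (n - 1)))))"
    unfolding d_def[symmetric]
    by (rule summable_comparison_test'[OF summable_add[OF c s']]) (simp only: real_norm_def abs_norm_cancel norm_triangle_ineq)
  have "trig_series d t = cis t * trig_series c t"
  proof -
    have "trig_series d t = (\<Sum>n. d (Suc n) * cis (real (Suc n) * t))"
      unfolding trig_series_def
      by (subst suminf_split_head[OF trig_series_summable[OF d]]) (simp add: d_def)
    also have "\<dots> = (\<Sum>n. cis t * (c n * cis (real n * t)))"
      by (simp only: cis_Suc_mult) (simp add: d_def mult_ac)
    also have "\<dots> = cis t * trig_series c t"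
      unfolding trig_series_def by (rule suminf_mult[OF trig_series_summable[OF c]])
    finally show ?thesis .
  qed
  moreover have "trig_series (\<lambda>n. c (Suc n)) t = cis (- t) * (trig_series c t - c 0)"
  proof -
    have "trig_series c t - c 0 = (\<Sum>n. c (Suc n) * cis (real (Suc n) * t))"
      unfolding trig_series_def
      by (subst suminf_split_head[OF trig_series_summable[OF c]]) simp
    also have "\<dots> = (\<Sum>n. cis t * (c (Suc n) * cis (real n * t)))"
      by (simp only: cis_Suc_mult) (simp add: mult_ac)
    also have "\<dots> = cis t * trig_series (\<lambda>n. c (Suc n)) t"
      unfolding trig_series_def by (rule suminf_mult[OF trig_series_summable[OF c1]])
    finally show ?thesis by (simp add: mult.assoc[symmetric] cis_mult)
  qed
  moreover have "trig_series (\<lambda>n. c n + of_real e / 2 * (c (Suc n) + d n)) t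
      = trig_series c t + of_real e / 2 * (trig_series (\<lambda>n. c (Suc n)) t + trig_series d t)"
    by (simp only: trig_series_add[OF c s'] trig_series_cmult[OF s] trig_series_add[OF c1 d])
  moreover have "cis t + cis (- t) = 2 * of_real (cos t)"
    by (simp add: complex_eq_iff)
  then have "of_real e / 2 * ((cis t + cis (- t)) * T) = of_real e * of_real (cos t) * T" for T
    by simp
  then have "of_real e / 2 * (cis (- t) * T + cis t * T) = of_real e * of_real (cos t) * T" for T
    by (simp only: distrib_right add.commute)
  ultimately show "(1 + of_real e * of_real (cos t)) * trig_series c t
    = trig_series (\<lambda>n. c n + of_real e / 2 * (c (Suc n) + (if n = 0 then 0 else c (n - 1)))) t"
    unfolding d_def[symmetric] by (simp only: c0 distrib_right diff_zero mult_1)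
qed

text \<open>Summing the inequality gives S <= sum g + e S + e C, and e < 1 allows e S to be absorbed
  on the left. The a priori bound C controls the boundary terms and thereby excludes the
  exponentially growing solutions of the recurrence.\<close>

lemma summable_three_term:
  fixes f g :: "nat \<Rightarrow> real"
  assumes e: "0 \<le> e" "e < 1" and f: "\<And>n. 0 \<le> f n" "\<And>n. f n \<le> C"
    and g: "summable g" "\<And>n. 0 \<le> g n"
    and step: "\<And>n. f (Suc n) \<le> g n + e / 2 * (f n + f (Suc (Suc n)))"
  shows "summable f"
proof -
  have "(\<Sum>n<N. f (Suc n)) \<le> (suminf g + e * C) / (1 - e)" for N
  proof -
    let ?S = "\<Sum>n<N. f (Suc n)"
    \<comment> \<open>Both shifted sums differ from \<open>?S\<close> by two boundary terms; the
      ones entering with a plus sign are together at most 2 C.\<close>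
    have 1: "(\<Sum>n<N. f n) = ?S + f 0 - f N" by (induction N) auto
    have 2: "(\<Sum>n<N. f (Suc (Suc n))) = ?S + f (Suc N) - f 1" by (induction N) auto
    have "?S \<le> (\<Sum>n<N. g n + e / 2 * (f n + f (Suc (Suc n))))"
      by (intro sum_mono step)
    also have "\<dots> = (\<Sum>n<N. g n) + e / 2 * ((\<Sum>n<N. f n) + (\<Sum>n<N. f (Suc (Suc n))))"
      by (simp only: sum.distrib sum_distrib_left[symmetric])
    also have "\<dots> \<le> suminf g + e / 2 * (2 * ?S + 2 * C)"
    proof (rule add_mono)
      show "(\<Sum>n<N. g n) \<le> suminf g" by (intro sum_le_suminf g) auto
      have "(\<Sum>n<N. f n) + (\<Sum>n<N. f (Suc (Suc n))) \<le> 2 * ?S + 2 * C"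
        using f(1)[of N] f(2)[of 0] f(1)[of 1] f(2)[of "Suc N"] unfolding 1 2 by linarith
      then show "e / 2 * ((\<Sum>n<N. f n) + (\<Sum>n<N. f (Suc (Suc n)))) \<le> e / 2 * (2 * ?S + 2 * C)"
        using e by (intro mult_left_mono) auto
    qed
    finally have "?S * (1 - e) \<le> suminf g + e * C" by (simp add: algebra_simps)
    then show ?thesis using e by (simp add: pos_le_divide_eq)
  qed
  then have "summable (\<lambda>n. f (Suc n))"
    by (intro summableI_nonneg_bounded) (auto simp: f)
  then show ?thesis by (simp add: summable_Suc_iff)
qed

text \<open>The constant term is a parameter because it is not \<open>fourier f 0\<close>. In a real
  solution, mode 0 is shared between the positive part and its conjugate, so that c + cnj c is the
  original mean.\<close>

definition positive_coeff :: "(real \<Rightarrow> complex) \<Rightarrow> complex \<Rightarrow> nat \<Rightarrow> complex" where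
  "positive_coeff f c n = (if n = 0 then c else fourier f (int n))"

section \<open>The weight 1 + e cos t and its three-term recurrence\<close>

lemma one_plus_e_cos_pos:
  fixes e t :: real
  assumes "0 \<le> e" "e < 1"
  shows "0 < 1 + e * cos t"
proof -
  have "e * (-1) \<le> e * cos t" by (rule mult_left_mono[OF cos_ge_minus_one assms(1)])
  then show ?thesis using assms by simp
qed

lemma one_plus_e_cos_ne_0:
  fixes e t :: real
  assumes "0 \<le> e" "e < 1"
  shows "1 + complex_of_real e * complex_of_real (cos t) \<noteq> 0"
  using one_plus_e_cos_pos[OF assms, of t]
  by (metis less_irrefl of_real_1 of_real_add of_real_eq_0_iff of_real_mult)

lemma continuous_on_vector_derivative:
  assumes "\<And>t. t \<in> S \<Longrightarrow> (f has_vector_derivative f' t) (at t within S)"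
  shows "continuous_on S f"
  unfolding continuous_on_eq_continuous_within
  by (intro ballI) (rule has_vector_derivative_continuous[OF assms])

text \<open>Multiplying by the weight, instead of expanding its reciprocal, couples only
  neighbouring modes. The F n are coefficients of the continuous function u', hence bounded.\<close>

lemma kepler_pair_fourier:
  fixes a e :: real and x u :: "real \<Rightarrow> complex"
  assumes e: "0 \<le> e" "e < 1" and x: "continuous_on {0..2 * pi} x"
    and u: "\<And>t. t \<in> {0..2 * pi} \<Longrightarrow> (u has_vector_derivative
      of_real a * x t / (1 + of_real e * of_real (cos t))) (at t within {0..2 * pi})"
    and per: "u (2 * pi) = u 0"
  defines "F \<equiv> \<lambda>n. \<i> * of_int n * fourier u n"
  shows "of_real a * fourier x n = F n + of_real e / 2 * (F (n - 1) + F (n + 1))"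
    and "\<exists>B. \<forall>n. norm (F n) \<le> B"
proof -
  define f where "f t = of_real a * x t / (1 + of_real e * of_real (cos t))" for t
  have f: "continuous_on {0..2 * pi} f"
    unfolding f_def using one_plus_e_cos_ne_0[OF e]
    by (intro continuous_intros x) auto
  have F: "fourier f n = F n" for n
    unfolding F_def using u f per by (intro fourier_deriv) (auto simp: f_def)
  have "of_real a * fourier x n = fourier (\<lambda>t. of_real a * x t) n"
    by (simp only: fourier_cmult)
  also have "\<dots> = fourier (\<lambda>t. f t + of_real e * (of_real (cos t) * f t)) n"
  proof (rule fourier_cong)
    fix t
    have "of_real a * x t = (1 + of_real e * of_real (cos t)) * f t"
      unfolding f_def using one_plus_e_cos_ne_0[OF e, of t] by simp
    then show "of_real a * x t = f t + of_real e * (of_real (cos t) * f t)"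
      by (simp add: algebra_simps)
  qed
  also have "\<dots> = fourier f n + of_real e * fourier (\<lambda>t. of_real (cos t) * f t) n"
    by (subst fourier_add; (intro continuous_intros f)?; simp only: fourier_cmult)
  finally show "of_real a * fourier x n = F n + of_real e / 2 * (F (n - 1) + F (n + 1))"
    by (simp add: fourier_cos[OF f] F)
  obtain B where "\<And>n. norm (fourier f n) \<le> B" using fourier_bounded[OF f] by blast
  then show "\<exists>B. \<forall>n. norm (F n) \<le> B" unfolding F by blast
qed

text \<open>The recurrence is solved for its middle term, so that summability of the coefficients of
  x passes to those of u' by \<open>summable_three_term\<close>.\<close>

lemma kepler_pair_summable:
  fixes a e :: real and x u :: "real \<Rightarrow> complex"
  assumes e: "0 \<le> e" "e < 1" and x: "continuous_on {0..2 * pi} x"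
    and u: "\<And>t. t \<in> {0..2 * pi} \<Longrightarrow> (u has_vector_derivative
      of_real a * x t / (1 + of_real e * of_real (cos t))) (at t within {0..2 * pi})"
    and per: "u (2 * pi) = u 0"
    and sx: "summable (\<lambda>n. norm (fourier x (int n)))"
  shows "summable (\<lambda>n. norm (\<i> * of_nat n * fourier u (int n)))"
proof -
  note * = kepler_pair_fourier[OF e x u per]
  define F where "F n = \<i> * of_int n * fourier u n" for n :: int
  obtain B where B: "\<And>n. norm (F n) \<le> B" using *(2) by (auto simp: F_def)
  have "summable (\<lambda>n. norm (F (int n)))"
  proof (rule summable_three_term[OF e])
    show "summable (\<lambda>n. norm (of_real a * fourier x (int (Suc n))))"
      unfolding norm_mult using sx by (intro summable_mult) (subst summable_Suc_iff)
    show "norm (F (int (Suc n))) \<le> norm (of_real a * fourier x (int (Suc n)))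
      + e / 2 * (norm (F (int n)) + norm (F (int (Suc (Suc n)))))" for n
    proof -
      have "F (int (Suc n)) = of_real a * fourier x (int (Suc n))
         - of_real (e / 2) * (F (int n) + F (int (Suc (Suc n))))"
        using *(1)[of "int (Suc n)", folded F_def] by (simp add: algebra_simps)
      also have "norm \<dots> \<le> norm (of_real a * fourier x (int (Suc n)))
         + norm (of_real (e / 2) * (F (int n) + F (int (Suc (Suc n)))))"
        by (rule norm_triangle_ineq4)
      also have "norm (of_real (e / 2) * (F (int n) + F (int (Suc (Suc n)))))
         \<le> e / 2 * (norm (F (int n)) + norm (F (int (Suc (Suc n)))))"
        unfolding norm_mult using e by (simp add: norm_triangle_ineq mult_left_mono)
      finally show ?thesis by simp
    qed
  qed (use B in auto)
  then show ?thesis by (simp add: F_def)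
qed

text \<open>For n > 0 the recurrence uses only F at indices >= 0 and so survives the truncation. At
  n = 0 it fixes the constant term of the x-part: F_1 = \<i> u_1 gives
  \<open>\<i> * e * fourier u 1 / (2 * a)\<close>. The constant c of u stays free here, since only
  u' enters.\<close>

lemma kepler_pair_positive:
  fixes a e :: real and x u :: "real \<Rightarrow> complex"
  assumes e: "0 \<le> e" "e < 1" and a: "a \<noteq> 0" and x: "continuous_on {0..2 * pi} x"
    and u: "\<And>t. t \<in> {0..2 * pi} \<Longrightarrow> (u has_vector_derivative
      of_real a * x t / (1 + of_real e * of_real (cos t))) (at t within {0..2 * pi})"
    and per: "u (2 * pi) = u 0"
    and su: "summable (\<lambda>n. norm (fourier u (int n)))"
    and snu: "summable (\<lambda>n. norm (\<i> * of_nat n * fourier u (int n)))"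
  shows "(trig_series (positive_coeff u c) has_vector_derivative
    of_real a * trig_series (positive_coeff x (\<i> * of_real e * fourier u 1 / (2 * of_real a))) t
      / (1 + of_real e * of_real (cos t))) (at t within A)"
proof -
  define F where "F n = \<i> * of_nat n * positive_coeff u c n" for n :: nat
  have F: "F n = \<i> * of_nat n * fourier u (int n)" for n
    by (simp add: F_def positive_coeff_def)
  have sF: "summable (\<lambda>n. norm (F n))" unfolding F by (rule snu)
  have su': "summable (\<lambda>n. norm (positive_coeff u c n))"
    using su by (subst summable_Suc_iff[symmetric], subst (asm) summable_Suc_iff[symmetric])
      (simp add: positive_coeff_def)
  let ?x = "positive_coeff x (\<i> * of_real e * fourier u 1 / (2 * of_real a))"
  have eq: "F n + of_real e / 2 * (F (Suc n) + (if n = 0 then 0 else F (n - 1))) = of_real a * ?x n" for n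
  proof (cases n)
    case 0
    then show ?thesis using a by (simp add: F positive_coeff_def field_simps)
  next
    case (Suc m)
    then show ?thesis
      using kepler_pair_fourier(1)[OF e x u per, of "int n"]
      by (simp add: F positive_coeff_def algebra_simps)
  qed
  have "F 0 = 0" by (simp add: F)
  note m = trig_series_mult_cos[OF sF this, of e, unfolded eq]
  \<comment> \<open>Summability of the x-part is read off from the recurrence, whose left side is
    summable.\<close>
  have sx: "summable (\<lambda>n. norm (?x n))"
    using summable_mult[OF m(2), of "norm (1 / of_real a :: complex)"] a
    by (simp add: norm_mult norm_divide)
  have "trig_series F t = of_real a * trig_series ?x t / (1 + of_real e * of_real (cos t))"
    using m(1)[of t] one_plus_e_cos_ne_0[OF e, of t]
    unfolding trig_series_cmult[OF sx] by (metis nonzero_mult_div_cancel_left)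
  moreover have "(\<lambda>n. \<i> * of_nat n * positive_coeff u c n) = F"
    by (simp add: F_def fun_eq_iff)
  ultimately show ?thesis
    using trig_series_has_vector_derivative[OF su' sF[unfolded F_def], of t A] by simp
qed

lemma summable_fourier_of_weighted:
  assumes "summable (\<lambda>n. norm (\<i> * of_nat n * fourier f (int n)))"
  shows "summable (\<lambda>n. norm (fourier f (int n)))"
proof (rule summable_comparison_test'[OF assms])
  show "norm (norm (fourier f (int n))) \<le> norm (\<i> * of_nat n * fourier f (int n))" if "n \<ge> 1" for n
    using that mult_right_mono[of 1 "real n" "norm (fourier f (int n))"] by (simp add: norm_mult)
qed

lemma summable_positive_coeff:
  assumes "summable (\<lambda>n. norm (fourier f (int n)))"
  shows "summable (\<lambda>n. norm (positive_coeff f c n))"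
  using assms by (subst summable_Suc_iff[symmetric], subst (asm) summable_Suc_iff[symmetric])
    (simp add: positive_coeff_def)

lemma positive_coeff_weight: "of_nat n * positive_coeff f c n = of_nat n * fourier f (int n)"
  by (simp add: positive_coeff_def)

section \<open>Conjugation and the Hilbert transform of a single function\<close>

lemma has_vector_derivative_cnj_comp:
  "(f has_vector_derivative f') F \<Longrightarrow> ((\<lambda>t. cnj (f t)) has_vector_derivative cnj f') F"
  by (rule bounded_linear.has_vector_derivative[OF bounded_linear_cnj])

text \<open>Write 2 Im P = -\<i> P + \<i> cnj P. The conjugate of a one-sided series has modes n <=
  0 only and does not contribute at n > 0.\<close>

lemma fourier_conjugate:
  assumes f: "summable (\<lambda>n. norm (fourier f (int n)))" and n: "n > 0"
    and P: "continuous_on {0..2 * pi} (trig_series (positive_coeff f c))"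
  shows "fourier (\<lambda>t. of_real (2 * Im (trig_series (positive_coeff f c) t))) n = - \<i> * fourier f n"
proof -
  let ?P = "trig_series (positive_coeff f c)"
  have "of_real (2 * Im z) = - \<i> * z + \<i> * cnj z" for z
    by (simp add: complex_eq_iff)
  then have "fourier (\<lambda>t. of_real (2 * Im (?P t))) n = fourier (\<lambda>t. - \<i> * ?P t + \<i> * cnj (?P t)) n"
    by (simp only:)
  also have "\<dots> = fourier (\<lambda>t. - \<i> * ?P t) n + fourier (\<lambda>t. \<i> * cnj (?P t)) n"
    by (intro fourier_add continuous_intros P)
  also have "\<dots> = - \<i> * fourier ?P n + \<i> * cnj (fourier ?P (- n))"
    by (simp only: fourier_cmult fourier_cnj)
  also have "\<dots> = - \<i> * fourier f n"
    using n by (simp add: fourier_trig_series[OF summable_positive_coeff[OF f]] positive_coeff_def)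
  finally show ?thesis .
qed

text \<open>The transform acts on positive parts as multiplication by -\<i>, provided that the
  constant is rotated as well; this is the source of T^2 = -1.\<close>

lemma positive_coeff_conjugate:
  assumes f: "summable (\<lambda>n. norm (fourier f (int n)))"
    and P: "continuous_on {0..2 * pi} (trig_series (positive_coeff f c))"
    and k: "k = - \<i> * c"
  shows "trig_series (positive_coeff (\<lambda>t. of_real (2 * Im (trig_series (positive_coeff f c) t))) k) t
    = - \<i> * trig_series (positive_coeff f c) t"
proof -
  have "positive_coeff (\<lambda>t. of_real (2 * Im (trig_series (positive_coeff f c) t))) k
    = (\<lambda>n. - \<i> * positive_coeff f c n)"
    using fourier_conjugate[OF f _ P] k by (auto simp: fun_eq_iff positive_coeff_def)
  then show ?thesis by (simp only: trig_series_cmult[OF summable_positive_coeff[OF f]])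
qed

text \<open>The coefficients of a real function at n and -n are conjugate, so the positive part and
  its conjugate account for every mode except 0. The factor \<open>(- 1)\<close> matches the shape
  produced by \<open>periodic_solution_add\<close> and
  \<open>periodic_solution_cmult\<close>.\<close>

lemma fourier_minus_positive_part:
  fixes f :: "real \<Rightarrow> real"
  assumes f: "summable (\<lambda>n. norm (fourier (\<lambda>t. of_real (f t)) (int n)))" and n: "n \<noteq> 0"
    and c: "continuous_on {0..2 * pi} (\<lambda>t. complex_of_real (f t))"
    and P: "continuous_on {0..2 * pi} (trig_series (positive_coeff (\<lambda>t. of_real (f t)) k))"
  shows "fourier (\<lambda>t. of_real (f t) + (- 1) * (trig_series (positive_coeff (\<lambda>t. of_real (f t)) k) t
      + cnj (trig_series (positive_coeff (\<lambda>t. of_real (f t)) k) t))) n = 0"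
proof -
  let ?f = "\<lambda>t. complex_of_real (f t)"
  let ?P = "trig_series (positive_coeff ?f k)"
  have "fourier (\<lambda>t. ?f t + (- 1) * (?P t + cnj (?P t))) n
      = fourier ?f n + fourier (\<lambda>t. (- 1) * (?P t + cnj (?P t))) n"
    by (intro fourier_add continuous_intros c P)
  also have "fourier (\<lambda>t. (- 1) * (?P t + cnj (?P t))) n = (- 1) * fourier (\<lambda>t. ?P t + cnj (?P t)) n"
    by (rule fourier_cmult)
  also have "fourier (\<lambda>t. ?P t + cnj (?P t)) n = fourier ?P n + fourier (\<lambda>t. cnj (?P t)) n"
    by (intro fourier_add continuous_intros P)
  also have "fourier (\<lambda>t. cnj (?P t)) n = cnj (fourier ?P (- n))"
    by (rule fourier_cnj)
  also have "fourier ?f n + (- 1) * (fourier ?P n + cnj (fourier ?P (- n))) = 0"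
    using n fourier_cnj[of ?f n]
    by (simp add: fourier_trig_series[OF summable_positive_coeff[OF f]] positive_coeff_def)
  finally show ?thesis .
qed

lemma trig_series_positive_coeff_add:
  assumes "continuous_on {0..2 * pi} f" "continuous_on {0..2 * pi} g"
    and "summable (\<lambda>n. norm (fourier f (int n)))" "summable (\<lambda>n. norm (fourier g (int n)))"
    and "k = c + d"
  shows "trig_series (positive_coeff (\<lambda>t. f t + g t) k) t
    = trig_series (positive_coeff f c) t + trig_series (positive_coeff g d) t"
proof -
  have "positive_coeff (\<lambda>t. f t + g t) k = (\<lambda>n. positive_coeff f c n + positive_coeff g d n)"
    using assms by (simp add: fun_eq_iff positive_coeff_def fourier_add)
  then show ?thesis using assms by (simp only: trig_series_add summable_positive_coeff)
qed

lemma trig_series_positive_coeff_cmult: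
  assumes "summable (\<lambda>n. norm (fourier f (int n)))" and "k = r * c"
  shows "trig_series (positive_coeff (\<lambda>t. r * f t) k) t = r * trig_series (positive_coeff f c) t"
proof -
  have "positive_coeff (\<lambda>t. r * f t) k = (\<lambda>n. r * positive_coeff f c n)"
    using assms by (simp add: fun_eq_iff positive_coeff_def fourier_cmult)
  then show ?thesis using assms by (simp only: trig_series_cmult summable_positive_coeff)
qed

lemma positive_coeff_cong:
  assumes "\<And>t. t \<in> {0..2 * pi} \<Longrightarrow> f t = g t"
  shows "positive_coeff f c = positive_coeff g c"
  using fourier_cong[of f g, OF assms] by (simp add: fun_eq_iff positive_coeff_def)

subsection \<open>Periodic solutions and their positive parts\<close>

locale kepler =
  fixes a b e :: real
  assumes ab: "a \<noteq> 0" "b \<noteq> 0" and e: "0 \<le> e" "e < 1"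
begin

text \<open>
  The original unknowns are $(p_1, p_2, q_1, q_2) = (u + y, w - x, x, y)$.
\<close>

definition periodic_solution ::
  "(real \<Rightarrow> complex) \<Rightarrow> (real \<Rightarrow> complex) \<Rightarrow> (real \<Rightarrow> complex) \<Rightarrow> (real \<Rightarrow> complex) \<Rightarrow> bool" where
  "periodic_solution x y u w \<longleftrightarrow>
    (\<forall>t\<in>{0..2 * pi}.
      (x has_vector_derivative u t + 2 * y t) (at t within {0..2 * pi}) \<and>
      (y has_vector_derivative w t - 2 * x t) (at t within {0..2 * pi}) \<and>
      (u has_vector_derivative of_real a * x t / (1 + of_real e * of_real (cos t))) (at t within {0..2 * pi}) \<and>
      (w has_vector_derivative of_real b * y t / (1 + of_real e * of_real (cos t))) (at t within {0..2 * pi})) \<and>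
    x (2 * pi) = x 0 \<and> y (2 * pi) = y 0 \<and> u (2 * pi) = u 0 \<and> w (2 * pi) = w 0"

text \<open>
  The constant terms are forced by the mode-zero equations
  $a x_0 = \frac{e}{2} F_1$, $b y_0 = \frac{e}{2} G_1$, $u_0 = - 2 y_0$, $w_0 = 2 x_0$
  once all negative modes are dropped.
\<close>

abbreviation pos_x where "pos_x x u \<equiv> trig_series (positive_coeff x (\<i> * of_real e * fourier u 1 / (2 * of_real a)))"
abbreviation pos_y where "pos_y y w \<equiv> trig_series (positive_coeff y (\<i> * of_real e * fourier w 1 / (2 * of_real b)))"
abbreviation pos_u where "pos_u u w \<equiv> trig_series (positive_coeff u (- 2 * (\<i> * of_real e * fourier w 1 / (2 * of_real b))))"
abbreviation pos_w where "pos_w w u \<equiv> trig_series (positive_coeff w (2 * (\<i> * of_real e * fourier u 1 / (2 * of_real a))))"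

lemma periodic_solutionD:
  assumes "periodic_solution x y u w"
  shows "\<And>t. t \<in> {0..2 * pi} \<Longrightarrow> (x has_vector_derivative u t + 2 * y t) (at t within {0..2 * pi})"
    and "\<And>t. t \<in> {0..2 * pi} \<Longrightarrow> (y has_vector_derivative w t - 2 * x t) (at t within {0..2 * pi})"
    and "\<And>t. t \<in> {0..2 * pi} \<Longrightarrow> (u has_vector_derivative of_real a * x t / (1 + of_real e * of_real (cos t))) (at t within {0..2 * pi})"
    and "\<And>t. t \<in> {0..2 * pi} \<Longrightarrow> (w has_vector_derivative of_real b * y t / (1 + of_real e * of_real (cos t))) (at t within {0..2 * pi})"
    and "x (2 * pi) = x 0" "y (2 * pi) = y 0" "u (2 * pi) = u 0" "w (2 * pi) = w 0"
  using assms unfolding periodic_solution_def by blast+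

lemma periodic_solution_continuous:
  assumes "periodic_solution x y u w"
  shows "continuous_on {0..2 * pi} x" "continuous_on {0..2 * pi} y"
    "continuous_on {0..2 * pi} u" "continuous_on {0..2 * pi} w"
  by (rule continuous_on_vector_derivative, erule periodic_solutionD(1-4)[OF assms])+

lemma periodic_solution_fourier:
  assumes s: "periodic_solution x y u w"
  shows "\<i> * of_int n * fourier x n = fourier u n + 2 * fourier y n"
    and "\<i> * of_int n * fourier y n = fourier w n - 2 * fourier x n"
proof -
  note c = periodic_solution_continuous[OF s]
  have "fourier (\<lambda>t. u t + 2 * y t) n = \<i> * of_int n * fourier x n"
    by (rule fourier_deriv[OF periodic_solutionD(1)[OF s]]) (auto intro!: continuous_intros c periodic_solutionD(5)[OF s])
  moreover have "fourier (\<lambda>t. u t + 2 * y t) n = fourier u n + fourier (\<lambda>t. 2 * y t) n"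
    by (intro fourier_add continuous_intros c)
  ultimately show "\<i> * of_int n * fourier x n = fourier u n + 2 * fourier y n"
    by (simp add: fourier_cmult)
  have "fourier (\<lambda>t. w t - 2 * x t) n = \<i> * of_int n * fourier y n"
    by (rule fourier_deriv[OF periodic_solutionD(2)[OF s]]) (auto intro!: continuous_intros c periodic_solutionD(6)[OF s])
  moreover have "fourier (\<lambda>t. w t - 2 * x t) n = fourier w n - fourier (\<lambda>t. 2 * x t) n"
    by (intro fourier_diff continuous_intros c)
  ultimately show "\<i> * of_int n * fourier y n = fourier w n - 2 * fourier x n"
    by (simp add: fourier_cmult)
qed

text \<open>Bootstrapping: the bounds on u_n and w_n make n x_n and n y_n bounded; the bounds on n
  u_n and n w_n from the recurrence then make n^2 x_n and n^2 y_n bounded, and the sum of 1/n^2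
  converges.\<close>

lemma periodic_solution_summable_xy:
  assumes s: "periodic_solution x y u w"
  shows "summable (\<lambda>n. norm (fourier x (int n)))" "summable (\<lambda>n. norm (fourier y (int n)))"
proof -
  note c = periodic_solution_continuous[OF s]
  obtain A where A: "\<And>n. norm (fourier x n) \<le> A" using fourier_bounded[OF c(1)] by blast
  obtain B where B: "\<And>n. norm (fourier y n) \<le> B" using fourier_bounded[OF c(2)] by blast
  obtain C where C: "\<And>n. norm (fourier u n) \<le> C" using fourier_bounded[OF c(3)] by blast
  obtain D where D: "\<And>n. norm (fourier w n) \<le> D" using fourier_bounded[OF c(4)] by blast
  obtain C' where C': "\<And>n. norm (\<i> * of_int n * fourier u n) \<le> C'"
    using kepler_pair_fourier(2)[OF e c(1) periodic_solutionD(3)[OF s] periodic_solutionD(7)[OF s]] by blast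
  obtain D' where D': "\<And>n. norm (\<i> * of_int n * fourier w n) \<le> D'"
    using kepler_pair_fourier(2)[OF e c(2) periodic_solutionD(4)[OF s] periodic_solutionD(8)[OF s]] by blast
  have nx: "real n * norm (fourier x (int n)) \<le> C + 2 * B" for n
  proof -
    have "real n * norm (fourier x (int n)) = norm (\<i> * of_int (int n) * fourier x (int n))"
      by (simp add: norm_mult)
    also have "\<dots> \<le> norm (fourier u (int n)) + norm (2 * fourier y (int n))"
      unfolding periodic_solution_fourier(1)[OF s] by (rule norm_triangle_ineq)
    also have "\<dots> \<le> C + 2 * B" using B[of "int n"] C[of "int n"] by (simp add: norm_mult)
    finally show ?thesis .
  qed
  have ny: "real n * norm (fourier y (int n)) \<le> D + 2 * A" for n
  proof -
    have "real n * norm (fourier y (int n)) = norm (\<i> * of_int (int n) * fourier y (int n))"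
      by (simp add: norm_mult)
    also have "\<dots> \<le> norm (fourier w (int n)) + norm (2 * fourier x (int n))"
      unfolding periodic_solution_fourier(2)[OF s] by (rule norm_triangle_ineq4)
    also have "\<dots> \<le> D + 2 * A" using A[of "int n"] D[of "int n"] by (simp add: norm_mult)
    finally show ?thesis .
  qed
  have decay: "summable (\<lambda>n. norm (f n))"
    if "\<And>n. real n * (real n * norm (f n)) \<le> M" for f :: "nat \<Rightarrow> complex" and M
  proof (rule summable_comparison_test')
    show "summable (\<lambda>n. M * inverse (real n ^ 2))"
      by (intro summable_mult inverse_power_summable) simp
    show "norm (norm (f n)) \<le> M * inverse (real n ^ 2)" if "n \<ge> 1" for n
      using \<open>real n * (real n * norm (f n)) \<le> M\<close> that
      by (simp add: field_simps power2_eq_square)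
  qed
  show "summable (\<lambda>n. norm (fourier x (int n)))"
  proof (rule decay)
    fix n
    have "real n * norm (fourier x (int n)) = norm (\<i> * of_int (int n) * fourier x (int n))"
      by (simp add: norm_mult)
    also have "\<dots> \<le> norm (fourier u (int n)) + norm (2 * fourier y (int n))"
      unfolding periodic_solution_fourier(1)[OF s] by (rule norm_triangle_ineq)
    finally have "real n * (real n * norm (fourier x (int n)))
        \<le> real n * (norm (fourier u (int n)) + norm (2 * fourier y (int n)))"
      by (rule mult_left_mono) simp
    also have "\<dots> = norm (\<i> * of_int (int n) * fourier u (int n)) + 2 * (real n * norm (fourier y (int n)))"
      by (simp add: norm_mult algebra_simps)
    also have "\<dots> \<le> C' + 2 * (D + 2 * A)" by (intro add_mono C' mult_left_mono ny) simp
    finally show "real n * (real n * norm (fourier x (int n))) \<le> C' + 2 * (D + 2 * A)" .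
  qed
  show "summable (\<lambda>n. norm (fourier y (int n)))"
  proof (rule decay)
    fix n
    have "real n * norm (fourier y (int n)) = norm (\<i> * of_int (int n) * fourier y (int n))"
      by (simp add: norm_mult)
    also have "\<dots> \<le> norm (fourier w (int n)) + norm (2 * fourier x (int n))"
      unfolding periodic_solution_fourier(2)[OF s] by (rule norm_triangle_ineq4)
    finally have "real n * (real n * norm (fourier y (int n)))
        \<le> real n * (norm (fourier w (int n)) + norm (2 * fourier x (int n)))"
      by (rule mult_left_mono) simp
    also have "\<dots> = norm (\<i> * of_int (int n) * fourier w (int n)) + 2 * (real n * norm (fourier x (int n)))"
      by (simp add: norm_mult algebra_simps)
    also have "\<dots> \<le> D' + 2 * (C + 2 * B)" by (intro add_mono D' mult_left_mono nx) simp
    finally show "real n * (real n * norm (fourier y (int n))) \<le> D' + 2 * (C + 2 * B)" .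
  qed
qed

text \<open>Summability of x_n and y_n feeds the recurrences, which yield n u_n and n w_n; the first
  two equations then return n x_n and n y_n.\<close>

lemma periodic_solution_summable:
  assumes s: "periodic_solution x y u w"
  shows "summable (\<lambda>n. norm (\<i> * of_nat n * fourier x (int n)))"
    "summable (\<lambda>n. norm (\<i> * of_nat n * fourier y (int n)))"
    "summable (\<lambda>n. norm (\<i> * of_nat n * fourier u (int n)))"
    "summable (\<lambda>n. norm (\<i> * of_nat n * fourier w (int n)))"
proof -
  note c = periodic_solution_continuous[OF s]
  note xy = periodic_solution_summable_xy[OF s]
  show nu: "summable (\<lambda>n. norm (\<i> * of_nat n * fourier u (int n)))"
    by (rule kepler_pair_summable[OF e c(1) periodic_solutionD(3)[OF s] periodic_solutionD(7)[OF s] xy(1)])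
  show nw: "summable (\<lambda>n. norm (\<i> * of_nat n * fourier w (int n)))"
    by (rule kepler_pair_summable[OF e c(2) periodic_solutionD(4)[OF s] periodic_solutionD(8)[OF s] xy(2)])
  note uw = summable_fourier_of_weighted[OF nu] summable_fourier_of_weighted[OF nw]
  show "summable (\<lambda>n. norm (\<i> * of_nat n * fourier x (int n)))"
  proof (rule summable_comparison_test'[OF summable_add[OF uw(1) summable_mult[OF xy(2), of 2]]])
    fix n :: nat
    show "norm (norm (\<i> * of_nat n * fourier x (int n))) \<le> norm (fourier u (int n)) + 2 * norm (fourier y (int n))"
      using norm_triangle_ineq[of "fourier u (int n)" "2 * fourier y (int n)"]
        periodic_solution_fourier(1)[OF s, of "int n"] by (simp add: norm_mult)
  qed
  show "summable (\<lambda>n. norm (\<i> * of_nat n * fourier y (int n)))"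
  proof (rule summable_comparison_test'[OF summable_add[OF uw(2) summable_mult[OF xy(1), of 2]]])
    fix n :: nat
    show "norm (norm (\<i> * of_nat n * fourier y (int n))) \<le> norm (fourier w (int n)) + 2 * norm (fourier x (int n))"
      using norm_triangle_ineq4[of "fourier w (int n)" "2 * fourier x (int n)"]
        periodic_solution_fourier(2)[OF s, of "int n"] by (simp add: norm_mult)
  qed
qed

text \<open>All equations hold mode by mode, by inheritance for n > 0 and by the choice of constants
  for n = 0. Absolute convergence of the differentiated series turns this into differential
  equations.\<close>

lemma periodic_solution_positive:
  assumes s: "periodic_solution x y u w"
  shows "periodic_solution (pos_x x u) (pos_y y w) (pos_u u w) (pos_w w u)"
proof -
  note c = periodic_solution_continuous[OF s]
  note nsm = periodic_solution_summable[OF s]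
  note sm = nsm[THEN summable_fourier_of_weighted]
  note psm = sm[THEN summable_positive_coeff]
  let ?x = "positive_coeff x (\<i> * of_real e * fourier u 1 / (2 * of_real a))"
  let ?y = "positive_coeff y (\<i> * of_real e * fourier w 1 / (2 * of_real b))"
  let ?u = "positive_coeff u (- 2 * (\<i> * of_real e * fourier w 1 / (2 * of_real b)))"
  let ?w = "positive_coeff w (2 * (\<i> * of_real e * fourier u 1 / (2 * of_real a)))"
  have ex: "(\<lambda>n. \<i> * of_nat n * ?x n) = (\<lambda>n. ?u n + 2 * ?y n)"
    using periodic_solution_fourier(1)[OF s, of "int _"] by (auto simp: positive_coeff_def fun_eq_iff)
  have ey: "(\<lambda>n. \<i> * of_nat n * ?y n) = (\<lambda>n. ?w n + (- 2) * ?x n)"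
    using periodic_solution_fourier(2)[OF s, of "int _"] by (auto simp: positive_coeff_def fun_eq_iff)
  have two: "summable (\<lambda>n. norm (k * d n))" if "summable (\<lambda>n. norm (d n))" for k :: complex and d
    unfolding norm_mult by (intro summable_mult that)
  have "(trig_series ?x has_vector_derivative trig_series ?u t + 2 * trig_series ?y t) (at t within {0..2 * pi})" for t
    using trig_series_has_vector_derivative[of ?x t "{0..2 * pi}"] nsm(1) psm(1)
    unfolding ex trig_series_add[OF psm(3) two[OF psm(2)]] trig_series_cmult[OF psm(2)]
    by (simp add: mult.assoc positive_coeff_weight ex[symmetric])
  moreover have "(trig_series ?y has_vector_derivative trig_series ?w t - 2 * trig_series ?x t) (at t within {0..2 * pi})" for t
    using trig_series_has_vector_derivative[of ?y t "{0..2 * pi}"] nsm(2) psm(2)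
    unfolding ey trig_series_add[OF psm(4) two[OF psm(1)]] trig_series_cmult[OF psm(1)]
    by (simp add: mult.assoc positive_coeff_weight ey[symmetric])
  moreover have "(trig_series ?u has_vector_derivative of_real a * trig_series ?x t / (1 + of_real e * of_real (cos t))) (at t within {0..2 * pi})" for t
    by (rule kepler_pair_positive[OF e ab(1) c(1) periodic_solutionD(3)[OF s] periodic_solutionD(7)[OF s] sm(3) nsm(3)])
  moreover have "(trig_series ?w has_vector_derivative of_real b * trig_series ?y t / (1 + of_real e * of_real (cos t))) (at t within {0..2 * pi})" for t
    by (rule kepler_pair_positive[OF e ab(2) c(2) periodic_solutionD(4)[OF s] periodic_solutionD(8)[OF s] sm(4) nsm(4)])
  ultimately show ?thesis
    unfolding periodic_solution_def by (intro conjI ballI trig_series_2pi)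
qed

section \<open>Operations on solutions, ending with the Hilbert transform\<close>

lemma periodic_solution_add:
  assumes s: "periodic_solution x y u w" and s': "periodic_solution x' y' u' w'"
  shows "periodic_solution (\<lambda>t. x t + x' t) (\<lambda>t. y t + y' t) (\<lambda>t. u t + u' t) (\<lambda>t. w t + w' t)"
proof -
  note 1 = has_vector_derivative_add[OF periodic_solutionD(1)[OF s] periodic_solutionD(1)[OF s']]
    has_vector_derivative_add[OF periodic_solutionD(2)[OF s] periodic_solutionD(2)[OF s']]
    has_vector_derivative_add[OF periodic_solutionD(3)[OF s] periodic_solutionD(3)[OF s']]
    has_vector_derivative_add[OF periodic_solutionD(4)[OF s] periodic_solutionD(4)[OF s']]
  show ?thesis
    unfolding periodic_solution_def
    by (intro conjI ballI; (rule has_vector_derivative_eq_rhs, rule 1; assumption?)?)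
       (simp_all only: periodic_solutionD(5-8)[OF s] periodic_solutionD(5-8)[OF s'], simp_all add: algebra_simps add_divide_distrib)
qed

lemma periodic_solution_cmult:
  assumes s: "periodic_solution x y u w"
  shows "periodic_solution (\<lambda>t. c * x t) (\<lambda>t. c * y t) (\<lambda>t. c * u t) (\<lambda>t. c * w t)"
proof -
  note 1 = periodic_solutionD(1-4)[OF s, THEN has_vector_derivative_mult_right[where a = c]]
  show ?thesis
    unfolding periodic_solution_def
    by (intro conjI ballI; (rule has_vector_derivative_eq_rhs, rule 1; assumption?)?)
       (simp_all only: periodic_solutionD(5-8)[OF s], simp_all add: algebra_simps)
qed

lemma periodic_solution_cnj:
  assumes s: "periodic_solution x y u w"
  shows "periodic_solution (\<lambda>t. cnj (x t)) (\<lambda>t. cnj (y t)) (\<lambda>t. cnj (u t)) (\<lambda>t. cnj (w t))"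
proof -
  note 1 = periodic_solutionD(1-4)[OF s, THEN has_vector_derivative_cnj_comp]
  show ?thesis
    unfolding periodic_solution_def
    by (intro conjI ballI; (rule has_vector_derivative_eq_rhs, rule 1; assumption?)?)
       (simp_all add: periodic_solutionD(5-8)[OF s])
qed

text \<open>Without modes 1 and -1 the recurrences at n = 0 read a x_0 = 0 and b y_0 = 0, and then
  u_0 = -2 y_0 and w_0 = 2 x_0 vanish too. Only the values at 0 are concluded, which suffices for
  initial vectors.\<close>

lemma periodic_solution_eq_0:
  assumes s: "periodic_solution x y u w"
    and "\<And>n. n \<noteq> 0 \<Longrightarrow> fourier x n = 0" "\<And>n. n \<noteq> 0 \<Longrightarrow> fourier y n = 0"
      "\<And>n. n \<noteq> 0 \<Longrightarrow> fourier u n = 0" "\<And>n. n \<noteq> 0 \<Longrightarrow> fourier w n = 0"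
  shows "x 0 = 0" "y 0 = 0" "u 0 = 0" "w 0 = 0"
proof -
  note c = periodic_solution_continuous[OF s]
  have x0: "fourier x 0 = 0"
    using kepler_pair_fourier(1)[OF e c(1) periodic_solutionD(3)[OF s] periodic_solutionD(7)[OF s], of 0] assms ab by simp
  have y0: "fourier y 0 = 0"
    using kepler_pair_fourier(1)[OF e c(2) periodic_solutionD(4)[OF s] periodic_solutionD(8)[OF s], of 0] assms ab by simp
  have u0: "fourier u 0 = 0" "fourier w 0 = 0"
    using periodic_solution_fourier[OF s, of 0] x0 y0 by auto
  have z: "fourier x n = 0" "fourier y n = 0" "fourier u n = 0" "fourier w n = 0" for n
    using x0 y0 u0 assms by metis+
  have "0 \<in> {0..2 * pi}" "2 * pi \<in> {0..2 * pi}" by auto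
  note d = periodic_solutionD(1-4)[OF s this(1)] periodic_solutionD(1-4)[OF s this(2)]
  show "x 0 = 0" by (rule fourier_eq_0_imp_0[OF c(1) periodic_solutionD(5)[OF s] d(1) d(5) z(1)])
  show "y 0 = 0" by (rule fourier_eq_0_imp_0[OF c(2) periodic_solutionD(6)[OF s] d(2) d(6) z(2)])
  show "u 0 = 0" by (rule fourier_eq_0_imp_0[OF c(3) periodic_solutionD(7)[OF s] d(3) d(7) z(3)])
  show "w 0 = 0" by (rule fourier_eq_0_imp_0[OF c(4) periodic_solutionD(8)[OF s] d(4) d(8) z(4)])
qed

text \<open>The system is linear with real coefficients, so -\<i> P + \<i> cnj P solves it along
  with P.\<close>

lemma periodic_solution_conjugate:
  assumes s: "periodic_solution x y u w"
  shows "periodic_solution (\<lambda>t. of_real (2 * Im (pos_x x u t))) (\<lambda>t. of_real (2 * Im (pos_y y w t)))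
    (\<lambda>t. of_real (2 * Im (pos_u u w t))) (\<lambda>t. of_real (2 * Im (pos_w w u t)))"
proof -
  note p = periodic_solution_positive[OF s]
  have eq: "of_real (2 * Im z) = - \<i> * z + \<i> * cnj z" for z
    by (simp add: complex_eq_iff)
  show ?thesis unfolding eq
    by (rule periodic_solution_add[OF periodic_solution_cmult[OF p]
          periodic_solution_cmult[OF periodic_solution_cnj[OF p]]])
qed

text \<open>The completing constants are complex linear in the first modes of u and w, which the
  transform multiplies by -\<i>; hence the constants rotate consistently with the other
  modes.\<close>

lemma pos_conjugate:
  assumes s: "periodic_solution x y u w"
  defines "x' \<equiv> \<lambda>t. complex_of_real (2 * Im (pos_x x u t))" and "y' \<equiv> \<lambda>t. complex_of_real (2 * Im (pos_y y w t))"
    and "u' \<equiv> \<lambda>t. complex_of_real (2 * Im (pos_u u w t))" and "w' \<equiv> \<lambda>t. complex_of_real (2 * Im (pos_w w u t))"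
  shows "pos_x x' u' t = - \<i> * pos_x x u t" "pos_y y' w' t = - \<i> * pos_y y w t"
    "pos_u u' w' t = - \<i> * pos_u u w t" "pos_w w' u' t = - \<i> * pos_w w u t"
proof -
  note sm = periodic_solution_summable[OF s, THEN summable_fourier_of_weighted]
  note c = periodic_solution_continuous[OF periodic_solution_positive[OF s]]
  have u: "fourier u' 1 = - \<i> * fourier u 1"
    unfolding u'_def by (rule fourier_conjugate[OF sm(3) _ c(3)]) simp
  have w: "fourier w' 1 = - \<i> * fourier w 1"
    unfolding w'_def by (rule fourier_conjugate[OF sm(4) _ c(4)]) simp
  show "pos_x x' u' t = - \<i> * pos_x x u t"
    unfolding x'_def by (rule positive_coeff_conjugate[OF sm(1) c(1)]) (simp add: u)
  show "pos_y y' w' t = - \<i> * pos_y y w t"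
    unfolding y'_def by (rule positive_coeff_conjugate[OF sm(2) c(2)]) (simp add: w)
  show "pos_u u' w' t = - \<i> * pos_u u w t"
    unfolding w by (subst u'_def) (rule positive_coeff_conjugate[OF sm(3) c(3)], simp)
  show "pos_w w' u' t = - \<i> * pos_w w u t"
    unfolding u by (subst w'_def) (rule positive_coeff_conjugate[OF sm(4) c(4)], simp)
qed

text \<open>The given solution minus P + cnj P is a solution whose nonzero modes all cancel, so
  \<open>periodic_solution_eq_0\<close> applies to it.\<close>

lemma real_periodic_solution_eq:
  fixes x y u w :: "real \<Rightarrow> real"
  assumes s: "periodic_solution (\<lambda>t. of_real (x t)) (\<lambda>t. of_real (y t)) (\<lambda>t. of_real (u t)) (\<lambda>t. of_real (w t))"
  shows "x 0 = 2 * Re (pos_x (\<lambda>t. of_real (x t)) (\<lambda>t. of_real (u t)) 0)"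
    "y 0 = 2 * Re (pos_y (\<lambda>t. of_real (y t)) (\<lambda>t. of_real (w t)) 0)"
    "u 0 = 2 * Re (pos_u (\<lambda>t. of_real (u t)) (\<lambda>t. of_real (w t)) 0)"
    "w 0 = 2 * Re (pos_w (\<lambda>t. of_real (w t)) (\<lambda>t. of_real (u t)) 0)"
proof -
  note p = periodic_solution_positive[OF s]
  note sm = periodic_solution_summable[OF s, THEN summable_fourier_of_weighted]
  note c = periodic_solution_continuous[OF s]
  note pc = periodic_solution_continuous[OF p]
  note z = periodic_solution_eq_0[OF periodic_solution_add[OF s
      periodic_solution_cmult[OF periodic_solution_add[OF p periodic_solution_cnj[OF p]], of "- 1"]],
      OF fourier_minus_positive_part[OF sm(1) _ c(1) pc(1)] fourier_minus_positive_part[OF sm(2) _ c(2) pc(2)]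
        fourier_minus_positive_part[OF sm(3) _ c(3) pc(3)] fourier_minus_positive_part[OF sm(4) _ c(4) pc(4)]]
  have re: "r = 2 * Re z" if "complex_of_real r + (- 1) * (z + cnj z) = 0" for r z
    using arg_cong[OF that, of Re] by simp
  show "x 0 = 2 * Re (pos_x (\<lambda>t. of_real (x t)) (\<lambda>t. of_real (u t)) 0)"
    by (rule re, (rule z(1); assumption))
  show "y 0 = 2 * Re (pos_y (\<lambda>t. of_real (y t)) (\<lambda>t. of_real (w t)) 0)"
    by (rule re, (rule z(2); assumption))
  show "u 0 = 2 * Re (pos_u (\<lambda>t. of_real (u t)) (\<lambda>t. of_real (w t)) 0)"
    by (rule re, (rule z(3); assumption))
  show "w 0 = 2 * Re (pos_w (\<lambda>t. of_real (w t)) (\<lambda>t. of_real (u t)) 0)"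
    by (rule re, (rule z(4); assumption))
qed

lemma pos_add:
  assumes s: "periodic_solution x y u w" and s': "periodic_solution x' y' u' w'"
  shows "pos_x (\<lambda>t. x t + x' t) (\<lambda>t. u t + u' t) t = pos_x x u t + pos_x x' u' t"
    "pos_y (\<lambda>t. y t + y' t) (\<lambda>t. w t + w' t) t = pos_y y w t + pos_y y' w' t"
    "pos_u (\<lambda>t. u t + u' t) (\<lambda>t. w t + w' t) t = pos_u u w t + pos_u u' w' t"
    "pos_w (\<lambda>t. w t + w' t) (\<lambda>t. u t + u' t) t = pos_w w u t + pos_w w' u' t"
proof -
  note sm = periodic_solution_summable[OF s, THEN summable_fourier_of_weighted]
    periodic_solution_summable[OF s', THEN summable_fourier_of_weighted]
  note c = periodic_solution_continuous[OF s] periodic_solution_continuous[OF s']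
  have u: "fourier (\<lambda>t. u t + u' t) 1 = fourier u 1 + fourier u' 1"
    and w: "fourier (\<lambda>t. w t + w' t) 1 = fourier w 1 + fourier w' 1"
    by (intro fourier_add c)+
  show "pos_x (\<lambda>t. x t + x' t) (\<lambda>t. u t + u' t) t = pos_x x u t + pos_x x' u' t"
    by (rule trig_series_positive_coeff_add[OF c(1,5) sm(1,5)]) (simp add: u distrib_left add_divide_distrib)
  show "pos_y (\<lambda>t. y t + y' t) (\<lambda>t. w t + w' t) t = pos_y y w t + pos_y y' w' t"
    by (rule trig_series_positive_coeff_add[OF c(2,6) sm(2,6)]) (simp add: w distrib_left add_divide_distrib)
  show "pos_u (\<lambda>t. u t + u' t) (\<lambda>t. w t + w' t) t = pos_u u w t + pos_u u' w' t"
    by (rule trig_series_positive_coeff_add[OF c(3,7) sm(3,7)]) (simp add: w distrib_left add_divide_distrib)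
  show "pos_w (\<lambda>t. w t + w' t) (\<lambda>t. u t + u' t) t = pos_w w u t + pos_w w' u' t"
    by (rule trig_series_positive_coeff_add[OF c(4,8) sm(4,8)]) (simp add: u distrib_left add_divide_distrib)
qed

lemma pos_cmult:
  assumes s: "periodic_solution x y u w"
  shows "pos_x (\<lambda>t. r * x t) (\<lambda>t. r * u t) t = r * pos_x x u t"
    "pos_y (\<lambda>t. r * y t) (\<lambda>t. r * w t) t = r * pos_y y w t"
    "pos_u (\<lambda>t. r * u t) (\<lambda>t. r * w t) t = r * pos_u u w t"
    "pos_w (\<lambda>t. r * w t) (\<lambda>t. r * u t) t = r * pos_w w u t"
  using periodic_solution_summable[OF s, THEN summable_fourier_of_weighted]
  by (auto intro!: trig_series_positive_coeff_cmult simp: fourier_cmult)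

end

subsection \<open>Complex structures\<close>

text \<open>A T-invariant subspace U is enlarged by v and T v, two dimensions at a time, until it
  exhausts S. T is assumed linear on S only, since it will be defined through solutions that start
  in S.\<close>

lemma even_dim_extend:
  fixes S U :: "'a::euclidean_space set"
  assumes S: "subspace S" and T: "\<And>v. v \<in> S \<Longrightarrow> T v \<in> S"
    and add: "\<And>v w. v \<in> S \<Longrightarrow> w \<in> S \<Longrightarrow> T (v + w) = T v + T w"
    and scale: "\<And>r v. v \<in> S \<Longrightarrow> T (r *\<^sub>R v) = r *\<^sub>R T v"
    and TT: "\<And>v. v \<in> S \<Longrightarrow> T (T v) = - v"
    and U: "subspace U" "U \<subseteq> S" "\<And>v. v \<in> U \<Longrightarrow> T v \<in> U" "even (dim U)"
  shows "even (dim S)"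
  using U
proof (induction "dim S - dim U" arbitrary: U rule: less_induct)
  case less
  show ?case
  proof (cases "U = S")
    case True
    then show ?thesis using less.prems by simp
  next
    case False
    then obtain v where v: "v \<in> S" "v \<notin> U" using less.prems(2) by blast
    have sU: "span U = U" using less.prems(1) by simp
    define W where "W = span (insert (T v) (insert v U))"
    have v': "T v \<notin> span (insert v U)"
    proof
      assume "T v \<in> span (insert v U)"
      then obtain k where "T v - k *\<^sub>R v \<in> U"
        using sU by (auto simp: span_breakdown_eq)
      then obtain u where u: "u \<in> U" "T v = k *\<^sub>R v + u"
        by (intro that[of "T v - k *\<^sub>R v"]) simp_all
      have uS: "u \<in> S" using u less.prems(2) by blast
      \<comment> \<open>Applying T to T v = k v + u turns a supposed dependence into (1 + k^2) v in
        U, and 1 + k^2 is never 0.\<close>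
      have "- v = T (k *\<^sub>R v + u)" using TT[OF v(1)] u(2) by simp
      also have "\<dots> = k *\<^sub>R (k *\<^sub>R v + u) + T u"
        using u uS v(1) S by (simp add: add scale subspace_scale)
      finally have "(1 + k\<^sup>2) *\<^sub>R v = - (k *\<^sub>R u + T u)"
        unfolding neg_eq_iff_add_eq_0 eq_neg_iff_add_eq_0
        by (simp add: scaleR_add_right scaleR_add_left power2_eq_square add.assoc)
      moreover have "- (k *\<^sub>R u + T u) \<in> U"
        using u less.prems(1,3) by (intro subspace_neg subspace_add subspace_scale) auto
      ultimately have "(1 / (1 + k\<^sup>2)) *\<^sub>R ((1 + k\<^sup>2) *\<^sub>R v) \<in> U"
        using less.prems(1) by (simp only: subspace_scale)
      moreover have "1 + k\<^sup>2 \<noteq> 0" using zero_le_power2[of k] by linarith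
      ultimately show False using v(2) by simp
    qed
    have "v \<notin> span U" unfolding sU by (rule v(2))
    with v' have dimW: "dim W = dim U + 2"
      unfolding W_def by (simp add: dim_insert)
    have WS: "W \<subseteq> S"
      unfolding W_def using v T less.prems(2) S by (intro span_minimal) auto
    have "T z \<in> W" if "z \<in> W" for z
    proof -
      from that obtain k l where "z - k *\<^sub>R T v - l *\<^sub>R v \<in> U"
        unfolding W_def using sU by (auto simp: span_breakdown_eq)
      then obtain u where u: "u \<in> U" "z = k *\<^sub>R T v + (l *\<^sub>R v + u)"
        by (intro that[of "z - k *\<^sub>R T v - l *\<^sub>R v"]) simp_all
      have uS: "u \<in> S" using u less.prems(2) by blast
      have "T z = k *\<^sub>R (- v) + (l *\<^sub>R T v + T u)"
        using u uS v(1) S T by (simp add: add scale TT subspace_scale subspace_add)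
      also have "\<dots> \<in> W"
        unfolding W_def using less.prems(3)[OF u(1)]
        by (intro span_add span_scale span_neg) (auto intro: span_base)
      finally show ?thesis .
    qed
    moreover have "dim W \<le> dim S" using WS by (rule dim_subset)
    ultimately show ?thesis
      using less.prems dimW WS by (intro less.hyps[of W]) (auto simp: W_def)
  qed
qed

lemma even_dim_complex_structure:
  fixes S :: "'a::euclidean_space set"
  assumes "subspace S" "\<And>v. v \<in> S \<Longrightarrow> T v \<in> S"
    and add: "\<And>v w. v \<in> S \<Longrightarrow> w \<in> S \<Longrightarrow> T (v + w) = T v + T w"
    and scale: "\<And>r v. v \<in> S \<Longrightarrow> T (r *\<^sub>R v) = r *\<^sub>R T v"
    and "\<And>v. v \<in> S \<Longrightarrow> T (T v) = - v"
  shows "even (dim S)"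
proof (rule even_dim_extend[of S T "{0}"])
  show "\<And>v. v \<in> {0} \<Longrightarrow> T v \<in> {0}"
    using scale[of 0 0] subspace_0[OF assms(1)] by simp
qed (use assms subspace_0 in \<open>auto\<close>)

subsection \<open>The fundamental solution\<close>

text \<open>Gronwall's argument: the factor exp (-2 L t) makes the weighted squared norm
  nonincreasing, and it starts at 0.\<close>

lemma eq_0_of_norm_derivative_le:
  fixes f :: "real \<Rightarrow> 'a::real_inner"
  assumes f: "\<And>t. t \<in> {0..T} \<Longrightarrow> (f has_vector_derivative f' t) (at t within {0..T})"
    and L: "\<And>t. t \<in> {0..T} \<Longrightarrow> norm (f' t) \<le> L * norm (f t)"
    and f0: "f 0 = 0" and s: "s \<in> {0..T}"
  shows "f s = 0"
proof -
  define g where "g t = (f t \<bullet> f t) * exp (- 2 * L * t)" for t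
  define g' where "g' t = (2 * (f t \<bullet> f' t) - 2 * L * (f t \<bullet> f t)) * exp (- 2 * L * t)" for t
  have "(g has_vector_derivative g' t) (at t within {0..s})" if "t \<in> {0..s}" for t
  proof -
    have "(f has_vector_derivative f' t) (at t within {0..s})"
      by (rule has_vector_derivative_within_subset[OF f]) (use that s in auto)
    then have 1: "(f has_derivative (\<lambda>h. h *\<^sub>R f' t)) (at t within {0..s})"
      by (simp only: has_vector_derivative_def)
    have "((\<lambda>t. f t \<bullet> f t) has_real_derivative 2 * (f t \<bullet> f' t)) (at t within {0..s})"
      unfolding has_field_derivative_def
      by (rule has_derivative_eq_rhs[OF has_derivative_inner[OF 1 1]])
         (simp add: fun_eq_iff inner_commute)
    moreover have "((\<lambda>t. exp (- 2 * L * t)) has_real_derivative - 2 * L * exp (- 2 * L * t)) (at t within {0..s})"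
      by (auto intro!: derivative_eq_intros)
    ultimately have "(g has_real_derivative g' t) (at t within {0..s})"
      unfolding g_def g'_def by (rule DERIV_cong[OF DERIV_mult]) (simp add: algebra_simps)
    then show ?thesis by (simp add: has_real_derivative_iff_has_vector_derivative)
  qed
  then have int: "(g' has_integral g s - g 0) {0..s}"
    using s by (intro fundamental_theorem_of_calculus) auto
  have "g' t \<le> 0" if "t \<in> {0..s}" for t
  proof -
    have "f t \<bullet> f' t \<le> norm (f t) * norm (f' t)" by (rule norm_cauchy_schwarz)
    also have "\<dots> \<le> norm (f t) * (L * norm (f t))"
      using L[of t] that s by (intro mult_left_mono) auto
    also have "\<dots> = L * (f t \<bullet> f t)" by (simp add: dot_square_norm power2_eq_square)
    finally show ?thesis by (simp add: g'_def mult_nonpos_nonneg)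
  qed
  then have "g s - g 0 \<le> 0"
    by (rule has_integral_le[OF int has_integral_0])
  then have "f s \<bullet> f s \<le> 0" by (simp add: g_def f0 mult_le_0_iff)
  then have "f s \<bullet> f s = 0" by (intro order_antisym inner_ge_zero)
  then show ?thesis by simp
qed

lemma vector_4 [simp]:
  "(vector [x, y, z, w] :: 'a::zero^4) $ 1 = x" "(vector [x, y, z, w] :: 'a^4) $ 2 = y"
  "(vector [x, y, z, w] :: 'a^4) $ 3 = z" "(vector [x, y, z, w] :: 'a^4) $ 4 = w"
  unfolding vector_def by simp_all

lemma Jmat_Bmat_mult:
  "(Jmat ** Bmat \<alpha> \<beta> e t) *v v = vector
    [v $ 2 - (1 - (1 + \<alpha> + 3 * \<beta>) / (1 + e * cos t)) * v $ 3,
     - v $ 1 - (1 - (1 + \<alpha> - 3 * \<beta>) / (1 + e * cos t)) * v $ 4,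
     v $ 1 + v $ 4, v $ 2 - v $ 3]"
  by (simp add: matrix_vector_mul_assoc[symmetric])
     (simp add: vec_eq_iff forall_4 matrix_vector_mult_def sum_4 Jmat_def Bmat_def)

lemma Jmat_Bmat_bounded:
  assumes e: "0 \<le> e" "e < 1"
  obtains L where "\<And>t v. norm ((Jmat ** Bmat \<alpha> \<beta> e t) *v v) \<le> L * norm v"
proof -
  \<comment> \<open>A bound for |1 - c / (1 + e cos t)| that is uniform in t, because the
    denominator is at least 1 - e.\<close>
  define K where "K c = 1 + \<bar>c\<bar> / (1 - e)" for c :: real
  have K: "\<bar>(1 - c / (1 + e * cos t)) * x\<bar> \<le> K c * \<bar>x\<bar>" for c t x
  proof -
    have r: "1 - e \<le> 1 + e * cos t"
      using mult_left_mono[OF cos_ge_minus_one[of t] e(1)] by simp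
    have "\<bar>1 - c / (1 + e * cos t)\<bar> \<le> 1 + \<bar>c / (1 + e * cos t)\<bar>" by linarith
    also have "\<bar>c / (1 + e * cos t)\<bar> \<le> \<bar>c\<bar> / (1 - e)"
      unfolding abs_divide using r e by (intro frac_le) auto
    finally show ?thesis unfolding abs_mult K_def by (intro mult_right_mono) auto
  qed
  have K0: "0 \<le> K c" for c using e by (simp add: K_def)
  have "norm ((Jmat ** Bmat \<alpha> \<beta> e t) *v v)
      \<le> (6 + K (1 + \<alpha> + 3 * \<beta>) + K (1 + \<alpha> - 3 * \<beta>)) * norm v" for t v
  proof -
    have c: "\<bar>v $ i\<bar> \<le> norm v" for i by (rule component_le_norm_cart)
    have "norm ((Jmat ** Bmat \<alpha> \<beta> e t) *v v)
       \<le> \<bar>v $ 2 - (1 - (1 + \<alpha> + 3 * \<beta>) / (1 + e * cos t)) * v $ 3\<bar>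
        + \<bar>- v $ 1 - (1 - (1 + \<alpha> - 3 * \<beta>) / (1 + e * cos t)) * v $ 4\<bar>
        + \<bar>v $ 1 + v $ 4\<bar> + \<bar>v $ 2 - v $ 3\<bar>"
      unfolding Jmat_Bmat_mult by (rule order_trans[OF norm_le_l1_cart]) (simp only: sum_4 vector_4 order_refl)
    also have "\<dots> \<le> (norm v + K (1 + \<alpha> + 3 * \<beta>) * norm v) + (norm v + K (1 + \<alpha> - 3 * \<beta>) * norm v)
        + 2 * norm v + 2 * norm v"
    proof -
      have k: "\<bar>(1 - d / (1 + e * cos t)) * v $ i\<bar> \<le> K d * norm v" for d i
        by (rule order_trans[OF K mult_left_mono[OF c K0]])
      have 1: "\<bar>v $ 2 - (1 - (1 + \<alpha> + 3 * \<beta>) / (1 + e * cos t)) * v $ 3\<bar> \<le> norm v + K (1 + \<alpha> + 3 * \<beta>) * norm v"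
        by (rule order_trans[OF abs_triangle_ineq4 add_mono[OF c k]])
      have 2: "\<bar>- v $ 1 - (1 - (1 + \<alpha> - 3 * \<beta>) / (1 + e * cos t)) * v $ 4\<bar> \<le> norm v + K (1 + \<alpha> - 3 * \<beta>) * norm v"
        by (rule order_trans[OF abs_triangle_ineq4 add_mono[OF _ k]]) (simp only: abs_minus_cancel c)
      have 3: "\<bar>v $ 1 + v $ 4\<bar> \<le> 2 * norm v"
        using order_trans[OF abs_triangle_ineq add_mono[OF c c]] by (simp only: mult_2)
      have 4: "\<bar>v $ 2 - v $ 3\<bar> \<le> 2 * norm v"
        using order_trans[OF abs_triangle_ineq4 add_mono[OF c c]] by (simp only: mult_2)
      show ?thesis by (intro add_mono 1 2 3 4)
    qed
    finally show ?thesis by (simp add: algebra_simps)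
  qed
  then show ?thesis by (rule that)
qed

lemma fundamental_solution_vector:
  assumes "fundamental_solution \<alpha> \<beta> e \<xi>" "t \<in> {0..2 * pi}"
  shows "((\<lambda>t. \<xi> t *v v) has_vector_derivative (Jmat ** Bmat \<alpha> \<beta> e t) *v (\<xi> t *v v))
    (at t within {0..2 * pi})"
proof -
  have "bounded_linear (\<lambda>M :: real^4^4. M *v v)"
    unfolding linear_conv_bounded_linear[symmetric]
    by (rule linearI) (simp_all add: matrix_vector_mult_add_rdistrib scaleR_matrix_vector_assoc)
  from bounded_linear.has_vector_derivative[OF this, of \<xi>] assms
  show ?thesis by (simp add: fundamental_solution_def matrix_vector_mul_assoc)
qed

text \<open>This ties solutions assembled from Fourier series to \<xi>: a periodic one has an
  initial vector fixed by the monodromy matrix \<xi> (2 pi).\<close>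

lemma fundamental_solution_unique:
  assumes \<xi>: "fundamental_solution \<alpha> \<beta> e \<xi>" and e: "0 \<le> e" "e < 1"
    and Z: "\<And>t. t \<in> {0..2 * pi} \<Longrightarrow>
      (Z has_vector_derivative (Jmat ** Bmat \<alpha> \<beta> e t) *v Z t) (at t within {0..2 * pi})"
    and t: "t \<in> {0..2 * pi}"
  shows "\<xi> t *v Z 0 = Z t"
proof -
  obtain L where L: "\<And>t v. norm ((Jmat ** Bmat \<alpha> \<beta> e t) *v v) \<le> L * norm v"
    using Jmat_Bmat_bounded[OF e] by blast
  have "\<xi> t *v Z 0 - Z t = 0"
  proof (rule eq_0_of_norm_derivative_le[OF _ _ _ t])
    show "((\<lambda>t. \<xi> t *v Z 0 - Z t) has_vector_derivative (Jmat ** Bmat \<alpha> \<beta> e t) *v (\<xi> t *v Z 0 - Z t))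
        (at t within {0..2 * pi})" if "t \<in> {0..2 * pi}" for t
      unfolding matrix_vector_mult_diff_distrib
      by (intro has_vector_derivative_diff fundamental_solution_vector[OF \<xi>] Z that)
  qed (use L \<xi> in \<open>auto simp: fundamental_solution_def\<close>)
  then show ?thesis by simp
qed

section \<open>The complex structure on the eigenspace of the monodromy matrix\<close>

lemma has_vector_derivative_vec_nth:
  "(z has_vector_derivative D) F \<Longrightarrow> ((\<lambda>t. z t $ i) has_vector_derivative D $ i) F"
  by (rule bounded_linear.has_vector_derivative[OF bounded_linear_vec_nth])

lemma has_vector_derivative_vector_4:
  fixes f1 f2 f3 f4 :: "real \<Rightarrow> real"
  assumes "(f1 has_vector_derivative d1) F" "(f2 has_vector_derivative d2) F"
    "(f3 has_vector_derivative d3) F" "(f4 has_vector_derivative d4) F"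
  shows "((\<lambda>t. vector [f1 t, f2 t, f3 t, f4 t] :: real^4) has_vector_derivative vector [d1, d2, d3, d4]) F"
proof -
  have eq: "(vector [x1, x2, x3, x4] :: real^4)
      = x1 *\<^sub>R axis 1 1 + x2 *\<^sub>R axis 2 1 + x3 *\<^sub>R axis 3 1 + x4 *\<^sub>R axis 4 1" for x1 x2 x3 x4 :: real
    by (simp add: vec_eq_iff forall_4 axis_def)
  have s: "((\<lambda>t. f t *\<^sub>R v) has_vector_derivative d *\<^sub>R v) F"
    if "(f has_vector_derivative d) F" for f d and v :: "real^4"
    by (rule bounded_linear.has_vector_derivative[OF bounded_linear_scaleR_left that])
  show ?thesis unfolding eq by (intro has_vector_derivative_add s assms)
qed

lemma has_vector_derivative_of_real_iff:
  "((\<lambda>t. complex_of_real (f t)) has_vector_derivative complex_of_real D) F \<longleftrightarrow> (f has_vector_derivative D) F"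
  using bounded_linear.has_vector_derivative[OF bounded_linear_of_real, of f D F]
    bounded_linear.has_vector_derivative[OF bounded_linear_Re, of "\<lambda>t. complex_of_real (f t)" "of_real D" F]
  by auto

lemma even_nu1_fundamental_solution:
  assumes \<xi>: "fundamental_solution \<alpha> \<beta> e \<xi>" and e: "0 \<le> e" "e < 1"
    and ab: "1 + \<alpha> + 3 * \<beta> \<noteq> 0" "1 + \<alpha> - 3 * \<beta> \<noteq> 0"
  shows "even (nu1 (\<xi> (2 * pi)))"
proof -
  define a b where "a = 1 + \<alpha> + 3 * \<beta>" and "b = 1 + \<alpha> - 3 * \<beta>"
  interpret kepler a b e by standard (use e ab in \<open>auto simp: a_def b_def\<close>)
  define S where "S = {v. \<xi> (2 * pi) *v v = v}"
  define x y u w where "x v t = complex_of_real ((\<xi> t *v v) $ 3)"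
    and "y v t = complex_of_real ((\<xi> t *v v) $ 4)"
    and "u v t = complex_of_real ((\<xi> t *v v) $ 1 - (\<xi> t *v v) $ 4)"
    and "w v t = complex_of_real ((\<xi> t *v v) $ 2 + (\<xi> t *v v) $ 3)" for v t
  have \<xi>0: "\<xi> 0 *v v = v" for v
    using \<xi> by (simp add: fundamental_solution_def)
  have sol: "periodic_solution (x v) (y v) (u v) (w v)" if "v \<in> S" for v
    unfolding periodic_solution_def
  proof (intro conjI ballI)
    fix t assume t: "t \<in> {0..2 * pi}"
    note d = fundamental_solution_vector[OF \<xi> t, of v, unfolded Jmat_Bmat_mult, THEN has_vector_derivative_vec_nth]
    have D: "((\<lambda>t. complex_of_real (f t)) has_vector_derivative z) (at t within {0..2 * pi})"
      if "(f has_vector_derivative D) (at t within {0..2 * pi})" "z = complex_of_real D" for f D z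
      using that by (simp add: has_vector_derivative_of_real_iff)
    show "(x v has_vector_derivative u v t + 2 * y v t) (at t within {0..2 * pi})"
      unfolding x_def[abs_def] by (rule D[OF d[of 3]]) (simp add: u_def y_def)
    show "(y v has_vector_derivative w v t - 2 * x v t) (at t within {0..2 * pi})"
      unfolding y_def[abs_def] by (rule D[OF d[of 4]]) (simp add: w_def x_def)
    show "(u v has_vector_derivative of_real a * x v t / (1 + of_real e * of_real (cos t))) (at t within {0..2 * pi})"
      unfolding u_def[abs_def]
      by (rule D[OF has_vector_derivative_diff[OF d[of 1] d[of 4]]]) (simp add: x_def a_def algebra_simps)
    show "(w v has_vector_derivative of_real b * y v t / (1 + of_real e * of_real (cos t))) (at t within {0..2 * pi})"
      unfolding w_def[abs_def]
      by (rule D[OF has_vector_derivative_add[OF d[of 2] d[of 3]]]) (simp add: y_def b_def algebra_simps)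
  qed (use that in \<open>simp_all add: S_def x_def y_def u_def w_def \<xi>0\<close>)
  \<comment> \<open>The converse of \<open>sol\<close>, and what places T v in S. Equality is
    claimed on [0, 2 pi] only, as \<xi> is unspecified elsewhere.\<close>
  have from_solution: "vector [h 0 + g 0, k 0 - f 0, f 0, g 0] \<in> S \<and>
      (\<forall>t\<in>{0..2 * pi}. x (vector [h 0 + g 0, k 0 - f 0, f 0, g 0]) t = of_real (f t) \<and>
        y (vector [h 0 + g 0, k 0 - f 0, f 0, g 0]) t = of_real (g t) \<and>
        u (vector [h 0 + g 0, k 0 - f 0, f 0, g 0]) t = of_real (h t) \<and>
        w (vector [h 0 + g 0, k 0 - f 0, f 0, g 0]) t = of_real (k t))"
    if s: "periodic_solution (\<lambda>t. of_real (f t)) (\<lambda>t. of_real (g t)) (\<lambda>t. of_real (h t)) (\<lambda>t. of_real (k t))"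
    for f g h k
  proof -
    define Z :: "real \<Rightarrow> real^4" where "Z t = vector [h t + g t, k t - f t, f t, g t]" for t
    have Z: "\<xi> t *v Z 0 = Z t" if t: "t \<in> {0..2 * pi}" for t
    proof (rule fundamental_solution_unique[OF \<xi> e _ t])
      fix t assume t: "t \<in> {0..2 * pi}"
      have D: "(f has_vector_derivative D) (at t within {0..2 * pi})"
        if "((\<lambda>t. complex_of_real (f t)) has_vector_derivative z) (at t within {0..2 * pi})"
          "z = complex_of_real D" for f D z
        using that by (simp add: has_vector_derivative_of_real_iff)
      note d = periodic_solutionD(1-4)[OF s t]
      have f: "(f has_vector_derivative h t + 2 * g t) (at t within {0..2 * pi})"
        by (rule D[OF d(1)]) simp
      have g: "(g has_vector_derivative k t - 2 * f t) (at t within {0..2 * pi})"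
        by (rule D[OF d(2)]) simp
      have h: "(h has_vector_derivative a * f t / (1 + e * cos t)) (at t within {0..2 * pi})"
        by (rule D[OF d(3)]) simp
      have k: "(k has_vector_derivative b * g t / (1 + e * cos t)) (at t within {0..2 * pi})"
        by (rule D[OF d(4)]) simp
      have "(Jmat ** Bmat \<alpha> \<beta> e t) *v Z t = vector
         [a * f t / (1 + e * cos t) + (k t - 2 * f t), b * g t / (1 + e * cos t) - (h t + 2 * g t),
          h t + 2 * g t, k t - 2 * f t]"
        by (simp add: Jmat_Bmat_mult Z_def vec_eq_iff forall_4 a_def b_def algebra_simps)
      then show "(Z has_vector_derivative (Jmat ** Bmat \<alpha> \<beta> e t) *v Z t) (at t within {0..2 * pi})"
        unfolding Z_def[abs_def]
        by (simp only:) (intro has_vector_derivative_vector_4 has_vector_derivative_add has_vector_derivative_diff f g h k)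
    qed
    have "Z (2 * pi) = Z 0"
      using periodic_solutionD(5-8)[OF s] by (simp add: Z_def)
    then show ?thesis
      using Z Z[of "2 * pi"] by (simp add: S_def x_def y_def u_def w_def Z_def)
  qed
  define X Y U W where "X v = pos_x (x v) (u v)" and "Y v = pos_y (y v) (w v)"
    and "U v = pos_u (u v) (w v)" and "W v = pos_w (w v) (u v)" for v
  \<comment> \<open>The initial vector, in the original unknowns, of the Hilbert transform of the
    solution starting at v.\<close>
  define T :: "real^4 \<Rightarrow> real^4" where "T v = vector [2 * Im (U v 0) + 2 * Im (Y v 0),
      2 * Im (W v 0) - 2 * Im (X v 0), 2 * Im (X v 0), 2 * Im (Y v 0)]" for v
  have TS: "T v \<in> S"
    and xT: "\<And>t. t \<in> {0..2 * pi} \<Longrightarrow> x (T v) t = of_real (2 * Im (X v t))"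
    and yT: "\<And>t. t \<in> {0..2 * pi} \<Longrightarrow> y (T v) t = of_real (2 * Im (Y v t))"
    and uT: "\<And>t. t \<in> {0..2 * pi} \<Longrightarrow> u (T v) t = of_real (2 * Im (U v t))"
    and wT: "\<And>t. t \<in> {0..2 * pi} \<Longrightarrow> w (T v) t = of_real (2 * Im (W v t))" if "v \<in> S" for v
    using from_solution[OF periodic_solution_conjugate[OF sol[OF that]], folded X_def Y_def U_def W_def, folded T_def]
    by blast+
  have "even (dim S)"
  proof (rule even_dim_complex_structure[of S T])
    show "subspace S"
      by (auto simp: subspace_def S_def matrix_vector_right_distrib matrix_vector_mult_scaleR)
    show "T v \<in> S" if "v \<in> S" for v by (rule TS[OF that])
    show "T (v + v') = T v + T v'" if "v \<in> S" "v' \<in> S" for v v'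
    proof -
      have "x (v + v') = (\<lambda>t. x v t + x v' t)" "y (v + v') = (\<lambda>t. y v t + y v' t)"
        "u (v + v') = (\<lambda>t. u v t + u v' t)" "w (v + v') = (\<lambda>t. w v t + w v' t)"
        by (simp_all add: x_def y_def u_def w_def fun_eq_iff matrix_vector_right_distrib)
      then have "X (v + v') 0 = X v 0 + X v' 0" "Y (v + v') 0 = Y v 0 + Y v' 0"
        "U (v + v') 0 = U v 0 + U v' 0" "W (v + v') 0 = W v 0 + W v' 0"
        unfolding X_def Y_def U_def W_def by (simp_all only: pos_add[OF sol sol, OF that])
      then show ?thesis by (simp add: T_def vec_eq_iff forall_4 algebra_simps)
    qed
    show "T (c *\<^sub>R v) = c *\<^sub>R T v" if "v \<in> S" for c v
    proof -
      have "x (c *\<^sub>R v) = (\<lambda>t. of_real c * x v t)" "y (c *\<^sub>R v) = (\<lambda>t. of_real c * y v t)"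
        "u (c *\<^sub>R v) = (\<lambda>t. of_real c * u v t)" "w (c *\<^sub>R v) = (\<lambda>t. of_real c * w v t)"
        by (simp_all add: x_def y_def u_def w_def fun_eq_iff matrix_vector_mult_scaleR algebra_simps)
      then have "X (c *\<^sub>R v) 0 = of_real c * X v 0" "Y (c *\<^sub>R v) 0 = of_real c * Y v 0"
        "U (c *\<^sub>R v) 0 = of_real c * U v 0" "W (c *\<^sub>R v) 0 = of_real c * W v 0"
        unfolding X_def Y_def U_def W_def by (simp_all only: pos_cmult[OF sol, OF that])
      then show ?thesis by (simp add: T_def vec_eq_iff forall_4 algebra_simps)
    qed
    show "T (T v) = - v" if v: "v \<in> S" for v
    proof -
      \<comment> \<open>The solution from T v and the transform agree only on [0, 2 pi]; this is
        enough because Fourier coefficients see nothing else.\<close>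
      have x: "positive_coeff (x (T v)) k = positive_coeff (\<lambda>t. of_real (2 * Im (X v t))) k" for k
        by (rule positive_coeff_cong) (rule xT[OF v])
      have y: "positive_coeff (y (T v)) k = positive_coeff (\<lambda>t. of_real (2 * Im (Y v t))) k" for k
        by (rule positive_coeff_cong) (rule yT[OF v])
      have u: "positive_coeff (u (T v)) k = positive_coeff (\<lambda>t. of_real (2 * Im (U v t))) k" for k
        by (rule positive_coeff_cong) (rule uT[OF v])
      have w: "positive_coeff (w (T v)) k = positive_coeff (\<lambda>t. of_real (2 * Im (W v t))) k" for k
        by (rule positive_coeff_cong) (rule wT[OF v])
      have u1: "fourier (u (T v)) 1 = fourier (\<lambda>t. of_real (2 * Im (U v t))) 1"
        by (rule fourier_cong) (rule uT[OF v])
      have w1: "fourier (w (T v)) 1 = fourier (\<lambda>t. of_real (2 * Im (W v t))) 1"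
        by (rule fourier_cong) (rule wT[OF v])
      have "X (T v) 0 = - \<i> * X v 0" "Y (T v) 0 = - \<i> * Y v 0"
        "U (T v) 0 = - \<i> * U v 0" "W (T v) 0 = - \<i> * W v 0"
        unfolding X_def[of "T v"] Y_def[of "T v"] U_def[of "T v"] W_def[of "T v"] x y u w u1 w1
        unfolding X_def Y_def U_def W_def
        by (rule pos_conjugate[OF sol[OF v]])+
      moreover have "v $ 3 = 2 * Re (X v 0)" "v $ 4 = 2 * Re (Y v 0)"
        "v $ 1 - v $ 4 = 2 * Re (U v 0)" "v $ 2 + v $ 3 = 2 * Re (W v 0)"
        using real_periodic_solution_eq[OF sol[OF v, unfolded x_def[abs_def] y_def[abs_def] u_def[abs_def] w_def[abs_def]]]
        by (simp_all only: \<xi>0 X_def Y_def U_def W_def x_def[abs_def] y_def[abs_def] u_def[abs_def] w_def[abs_def])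
      \<comment> \<open>Here 2 Im (-\<i> z) = -2 Re z, and twice the real parts of the positive
        parts recover v.\<close>
      ultimately show ?thesis
        by (simp add: T_def vec_eq_iff forall_4)
    qed
  qed
  moreover have "S = {v. (\<xi> (2 * pi) - mat 1) *v v = 0}"
    by (simp add: S_def matrix_vector_mult_diff_rdistrib)
  ultimately show ?thesis by (simp add: nu1_def)
qed

theorem theorem7p3:
  fixes ta tb e :: real and \<xi> :: "real \<Rightarrow> real^4^4"
  assumes "(ta, tb, e) \<in> R_NH \<union> R_EH"
    and "fundamental_solution (alpha_of_tilde ta tb) (beta_of_tilde ta tb) e \<xi>"
  shows "even (nu1 (\<xi> (2 * pi)))"
proof (rule even_nu1_fundamental_solution[OF assms(2)])
  \<comment> \<open>In tilde coordinates the two constants are 3 ta + 2 tb + 3, which exceeds 1, and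
    -tb. The second vanishes exactly on the wall tb = 0 that separates the two regions.\<close>
  have "-1 < tb" "tb \<noteq> 0" "0 < ta" using assms(1) by (auto simp: R_NH_def R_EH_def)
  moreover show "0 \<le> e" "e < 1" using assms(1) by (auto simp: R_NH_def R_EH_def)
  ultimately show "1 + alpha_of_tilde ta tb + 3 * beta_of_tilde ta tb \<noteq> 0"
    "1 + alpha_of_tilde ta tb - 3 * beta_of_tilde ta tb \<noteq> 0"
    by (auto simp: alpha_of_tilde_def beta_of_tilde_def field_simps)
qed

end
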